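(* Let $N\ge3$, let $\Omega\subset\mathbb R^N$ be a bounded domain whose boundary $\partial\Omega$ is $C^1$, with exterior unit normal $\nu$, and let $p,q>0$ and $\alpha,\beta\le 0$. Let $(u,v)\in (C^2(\overline\Omega))^2$ be a pair of non-negative functions solving $$-\Delta v=\frac{u^{p}}{(\ln(e+u))^{\alpha}}\ \text{ in }\Omega,\qquad -\Delta u=\frac{v^{q}}{(\ln(e+v))^{\beta}}\ \text{ in }\Omega,\qquad u=v=0\ \text{ on }\partial\Omega .$$ (1) If $$\frac1{p+1}+\frac1{q+1}=\frac{N-2}N$$ and $\Omega$ is strongly star-shaped with respect to $0$ (that is, $x\cdot\nu(x)\ge0$ for all $x\in\partial\Omega$ and $x\cdot\nu(x)\not\equiv0$ on $\partial\Omega$), then $u\equiv0$ and $v\equiv0$ in $\Omega$. (2) If $$\frac1{p+1}+\frac1{q+1}<\frac{N-2}N$$ and $\Omega$ is star-shaped with respect to $0$ (that is, $x\cdot\nu(x)\ge0$ for all $x\in\partial\Omega$), then $u\equiv0$ and $v\equiv0$ in $\Omega$.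
   Context: All notions are standard; $x\cdot\nu(x)$ denotes the Euclidean inner product. *)

theory Defs
  imports "HOL-Analysis.Analysis"
begin

text \<open>The space \<open>C^k\<close> of the closure of an open set \<open>S\<close>: all partial derivatives of
  order at most \<open>k\<close> exist in \<open>S\<close> (as iterated derivatives in coordinate directions) and have
  continuous extensions to the closure of \<open>S\<close>.  The witness \<open>g\<close> is the extension of
  \<open>\<partial>f/\<partial>b\<close>; for order 0 the values of \<open>f\<close> on the closure are used.  For
  \<open>S = UNIV\<close> this is ordinary \<open>C^k\<close>.\<close>

fun Ck_closure :: "nat \<Rightarrow> 'a::euclidean_space set \<Rightarrow> ('a \<Rightarrow> real) \<Rightarrow> bool" where
  "Ck_closure 0 S f \<longleftrightarrow> continuous_on (closure S) f"
| "Ck_closure (Suc k) S f \<longleftrightarrow>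
     continuous_on (closure S) f \<and>
     (\<forall>x\<in>S. f differentiable (at x)) \<and>
     (\<forall>b\<in>Basis. \<exists>g. Ck_closure k S g \<and> (\<forall>x\<in>S. g x = frechet_derivative f (at x) b))"

definition laplacian :: "('a::euclidean_space \<Rightarrow> real) \<Rightarrow> 'a \<Rightarrow> real" where
  "laplacian f x =
     (\<Sum>b\<in>Basis. frechet_derivative (\<lambda>y. frechet_derivative f (at y) b) (at x) b)"

definition bounded_domain :: "'a::euclidean_space set \<Rightarrow> bool" where
  "bounded_domain S \<longleftrightarrow> open S \<and> connected S \<and> S \<noteq> {} \<and> bounded S"

text \<open>Near \<open>x\<close>, the set \<open>S\<close> is the region above the graph of a \<open>C^1\<close> function in the
  direction of the unit vector \<open>e\<close>.  A function on the hyperplane orthogonal to \<open>e\<close> is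
  encoded as a function \<open>\<gamma>\<close> on the whole space that is constant along \<open>e\<close>.\<close>

definition C1_graph_at ::
  "'a::euclidean_space set \<Rightarrow> 'a \<Rightarrow> 'a \<Rightarrow> ('a \<Rightarrow> real) \<Rightarrow> bool" where
  "C1_graph_at S x e \<gamma> \<longleftrightarrow>
     norm e = 1 \<and> Ck_closure 1 UNIV \<gamma> \<and> (\<forall>y t. \<gamma> (y + t *\<^sub>R e) = \<gamma> y) \<and>
     (\<exists>r>0. S \<inter> ball x r = {y \<in> ball x r. \<gamma> y < y \<bullet> e})"

definition C1_boundary :: "'a::euclidean_space set \<Rightarrow> bool" where
  "C1_boundary S \<longleftrightarrow> (\<forall>x\<in>frontier S. \<exists>e \<gamma>. C1_graph_at S x e \<gamma>)"

text \<open>In a graph representation, \<open>S\<close> is locally \<open>{y. \<gamma> y - y \<bullet> e < 0}\<close>, so the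
  exterior unit normal is the normalized gradient of \<open>\<lambda>y. \<gamma> y - y \<bullet> e\<close>.\<close>

definition exterior_unit_normal :: "'a::euclidean_space set \<Rightarrow> ('a \<Rightarrow> 'a) \<Rightarrow> bool" where
  "exterior_unit_normal S \<nu> \<longleftrightarrow>
     (\<forall>x\<in>frontier S. \<exists>e \<gamma> D. C1_graph_at S x e \<gamma> \<and> GDERIV \<gamma> x :> D \<and> \<nu> x = sgn (D - e))"

definition star_shaped_0 :: "'a::euclidean_space set \<Rightarrow> ('a \<Rightarrow> 'a) \<Rightarrow> bool" where
  "star_shaped_0 S \<nu> \<longleftrightarrow> (\<forall>x\<in>frontier S. x \<bullet> \<nu> x \<ge> 0)"

definition strongly_star_shaped_0 :: "'a::euclidean_space set \<Rightarrow> ('a \<Rightarrow> 'a) \<Rightarrow> bool" where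
  "strongly_star_shaped_0 S \<nu> \<longleftrightarrow>
     (\<forall>x\<in>frontier S. x \<bullet> \<nu> x \<ge> 0) \<and> \<not> (\<forall>x\<in>frontier S. x \<bullet> \<nu> x = 0)"

end

theory Submission
  imports Defs
begin

text \<open>
The theorem follows from a Pohozaev identity, but the classical proof writes it with integrals
over \<open>\<partial>\<Omega>\<close>. The proof here never integrates over the boundary. For a function \<open>u\<close> with
gradient \<open>G\<close> and Hessian \<open>H\<close>, put
\<open>flux\<^sub>u \<psi> = \<integral> ((-\<Delta>u) \<psi> - \<nabla>u \<cdot> \<nabla>\<psi>)\<close>, an integral over \<open>\<Omega>\<close>,
which by the divergence theorem is \<open>-\<integral> \<partial>u/\<partial>\<nu> \<psi>\<close> over \<open>\<partial>\<Omega>\<close>. What is needed of the boundary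
integral can be read off from the volume integral:

 \<^item> if \<open>\<psi>\<close> or \<open>\<nabla>u\<close> vanishes at every boundary point, then \<open>flux\<^sub>u \<psi> = 0\<close> (\<open>flux_zero\<close>), since a
   field in \<open>C\<^sup>1\<close> that vanishes on the boundary has a divergence of integral 0
   (\<open>integral_gradient_zero\<close>);
 \<^item> if \<open>u \<ge> 0\<close> vanishes on the boundary, \<open>-\<Delta>u \<ge> 0\<close>, and \<open>\<psi> \<ge> 0\<close> on the boundary, then
   \<open>flux\<^sub>u \<psi> \<ge> 0\<close> (\<open>flux_nonneg_frontier\<close>): test with \<open>c\<^sub>n(u) \<psi> \<nabla>u\<close>, where the increasing cut-off
   \<open>c\<^sub>n(u)\<close> vanishes on the boundary and tends to 1.

For the solution pair, the choice \<open>\<psi> = -x \<cdot> \<nabla>v\<close> gives (\<open>pohozaev_identity\<close>)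
\<open>flux\<^sub>u (-x \<cdot> \<nabla>v) = N \<integral> (F(u) + \<Phi>(v)) - (N-2) \<integral> \<nabla>u \<cdot> \<nabla>v\<close>,
where \<open>F\<close> and \<open>\<Phi>\<close> are the antiderivatives of the two nonlinearities \<open>f\<close> and \<open>g\<close>. Star-shapedness and
\<open>v \<ge> 0\<close> give \<open>x \<cdot> \<nabla>v \<le> 0\<close> on the boundary, so the left side is nonnegative. On the right,
\<open>\<integral> \<nabla>u \<cdot> \<nabla>v = \<integral> u f(u) = \<integral> v g(v) = E\<close> and, as \<open>\<alpha>, \<beta> \<le> 0\<close>, \<open>(p+1) F(s) \<le> s f(s)\<close> and
\<open>(q+1) \<Phi>(s) \<le> s g(s)\<close>. Hence
\<open>0 \<le> flux\<^sub>u (-x \<cdot> \<nabla>v) \<le> (N/(p+1) + N/(q+1) - (N-2)) E\<close>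
(\<open>pohozaev_inequality\<close>). If \<open>1/(p+1) + 1/(q+1) < (N-2)/N\<close>, the bracket is negative, so
\<open>E = 0\<close>, because \<open>E \<ge> 0\<close>, and both functions vanish.

On the critical hyperbola \<open>1/(p+1) + 1/(q+1) = (N-2)/N\<close> the bracket is 0 and the flux vanishes. If
\<open>x \<cdot> \<nabla>v < 0\<close> at some boundary point, then \<open>-x \<cdot> \<nabla>v\<close> dominates a multiple of every nonnegative \<open>\<phi>\<close> supported near that point, hence
\<open>flux\<^sub>u \<phi> = 0\<close> there (\<open>flux_localizes\<close>). Otherwise \<open>x \<cdot> \<nabla>v = 0\<close> on the whole boundary, and near a point
with \<open>x \<cdot> \<nu> > 0\<close>, where \<open>x\<close> is transversal to the boundary, this forces \<open>\<nabla>v = 0\<close>, hence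
\<open>flux\<^sub>v \<phi> = 0\<close> for such \<open>\<phi>\<close>. In both cases one of the two functions, extended by 0 across a
piece of the boundary, is weakly superharmonic; being nonnegative and zero on an open set outside
\<open>\<Omega>\<close>, it vanishes near that piece and then, \<open>\<Omega>\<close> being connected, everywhere
(\<open>zero_if_flux_vanishes_near_frontier_point\<close>). This replaces the boundary point lemma of Hopf, which
can fail when the boundary is only \<open>C\<^sup>1\<close>. Finally, if one function vanishes then so does its Laplacian, which up to sign
is a nonlinearity of the other function that vanishes only at 0, and therefore the other function vanishes too.
\<close>

section \<open>Continuously differentiable functions up to the boundary\<close>

definition C1_with_gradient ::
  "'a::euclidean_space set \<Rightarrow> ('a \<Rightarrow> real) \<Rightarrow> ('a \<Rightarrow> 'a) \<Rightarrow> bool" where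
  "C1_with_gradient S w G \<longleftrightarrow>
     continuous_on (closure S) w \<and> continuous_on (closure S) G \<and> (\<forall>x\<in>S. GDERIV w x :> G x)"

lemma C1_with_gradientD:
  assumes "C1_with_gradient S w G"
  shows "continuous_on (closure S) w" "continuous_on (closure S) G"
    "\<And>x. x \<in> S \<Longrightarrow> GDERIV w x :> G x"
    "\<And>x. x \<in> S \<Longrightarrow> (w has_derivative (\<lambda>h. h \<bullet> G x)) (at x)"
  using assms by (auto simp: C1_with_gradient_def gderiv_def)

lemma C1_gradient_unique:
  assumes "C1_with_gradient S f F" "x \<in> S" "GDERIV f x :> D"
  shows "F x = D"
proof -
  have "(\<lambda>h. h \<bullet> F x) = (\<lambda>h. h \<bullet> D)"
    using has_derivative_unique[OF C1_with_gradientD(4)[OF assms(1,2)]] assms(3) by (simp add: gderiv_def)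
  then show ?thesis by (metis inner_commute vector_eq_ldot)
qed

lemma C1_const: "C1_with_gradient S (\<lambda>x. c) (\<lambda>x. 0)"
  by (auto simp: C1_with_gradient_def intro: GDERIV_const)

lemma C1_linear: "C1_with_gradient S (\<lambda>x. x \<bullet> b) (\<lambda>x. b)"
  by (auto simp: C1_with_gradient_def gderiv_def intro!: continuous_intros derivative_eq_intros)

lemma C1_add:
  assumes "C1_with_gradient S f F" "C1_with_gradient S g G"
  shows "C1_with_gradient S (\<lambda>x. f x + g x) (\<lambda>x. F x + G x)"
  using assms by (auto simp: C1_with_gradient_def intro!: continuous_intros GDERIV_add)

lemma C1_minus:
  assumes "C1_with_gradient S f F"
  shows "C1_with_gradient S (\<lambda>x. - f x) (\<lambda>x. - F x)"
  using assms by (auto simp: C1_with_gradient_def intro!: continuous_intros GDERIV_minus)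

lemma C1_diff:
  assumes "C1_with_gradient S f F" "C1_with_gradient S g G"
  shows "C1_with_gradient S (\<lambda>x. f x - g x) (\<lambda>x. F x - G x)"
  using assms by (auto simp: C1_with_gradient_def intro!: continuous_intros GDERIV_diff)

lemma C1_mult:
  assumes "C1_with_gradient S f F" "C1_with_gradient S g G"
  shows "C1_with_gradient S (\<lambda>x. f x * g x) (\<lambda>x. f x *\<^sub>R G x + g x *\<^sub>R F x)"
  using assms by (auto simp: C1_with_gradient_def intro!: continuous_intros GDERIV_mult)

lemma C1_sum:
  assumes "finite I" "\<And>i. i \<in> I \<Longrightarrow> C1_with_gradient S (f i) (F i)"
  shows "C1_with_gradient S (\<lambda>x. \<Sum>i\<in>I. f i x) (\<lambda>x. \<Sum>i\<in>I. F i x)"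
  using assms by (induction) (auto intro!: C1_const C1_add)

lemma C1_compose:
  assumes w: "C1_with_gradient S w G" and T: "\<And>x. x \<in> closure S \<Longrightarrow> w x \<in> T"
    and d: "\<And>t. t \<in> T \<Longrightarrow> (h has_real_derivative h' t) (at t)" and h': "continuous_on T h'"
  shows "C1_with_gradient S (\<lambda>x. h (w x)) (\<lambda>x. h' (w x) *\<^sub>R G x)"
proof -
  have h: "continuous_on T h"
    using d by (meson DERIV_isCont continuous_at_imp_continuous_on)
  have sub: "w ` closure S \<subseteq> T" using T by auto
  have "continuous_on (closure S) (\<lambda>x. h (w x))" "continuous_on (closure S) (\<lambda>x. h' (w x))"
    using continuous_on_compose2[OF h C1_with_gradientD(1)[OF w] sub]
      continuous_on_compose2[OF h' C1_with_gradientD(1)[OF w] sub] by auto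
  moreover have "GDERIV (\<lambda>x. h (w x)) x :> h' (w x) *\<^sub>R G x" if "x \<in> S" for x
    using that closure_subset T by (intro GDERIV_DERIV_compose[OF C1_with_gradientD(3)[OF w that] d]) auto
  ultimately show ?thesis
    using C1_with_gradientD(2)[OF w] by (auto simp: C1_with_gradient_def intro!: continuous_intros)
qed

lemma C1_inner:
  assumes "\<And>b. b \<in> Basis \<Longrightarrow> C1_with_gradient S (\<lambda>x. U x \<bullet> b) (J b)"
    and "\<And>b. b \<in> Basis \<Longrightarrow> C1_with_gradient S (\<lambda>x. V x \<bullet> b) (K b)"
  shows "C1_with_gradient S (\<lambda>x. U x \<bullet> V x)
           (\<lambda>x. (\<Sum>b\<in>Basis. (U x \<bullet> b) *\<^sub>R K b x) + (\<Sum>b\<in>Basis. (V x \<bullet> b) *\<^sub>R J b x))"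
proof -
  have "C1_with_gradient S (\<lambda>x. \<Sum>b\<in>Basis. (U x \<bullet> b) * (V x \<bullet> b))
     (\<lambda>x. \<Sum>b\<in>Basis. (U x \<bullet> b) *\<^sub>R K b x + (V x \<bullet> b) *\<^sub>R J b x)"
    using assms by (intro C1_sum C1_mult) auto
  then show ?thesis
    by (simp add: euclidean_inner[symmetric] sum.distrib)
qed

lemma C1_segment_derivative:
  assumes w: "C1_with_gradient S w G" and "x + t *\<^sub>R a \<in> S"
  shows "((\<lambda>s. w (x + s *\<^sub>R a)) has_real_derivative (G (x + t *\<^sub>R a) \<bullet> a)) (at t)"
proof -
  have "((\<lambda>s. w (x + s *\<^sub>R a)) has_derivative (\<lambda>h. (h *\<^sub>R a) \<bullet> G (x + t *\<^sub>R a))) (at t)"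
    by (rule has_derivative_compose[where f = "\<lambda>s. x + s *\<^sub>R a" and g = w])
       (auto intro!: derivative_eq_intros C1_with_gradientD(4)[OF assms])
  then show ?thesis
    by (simp add: has_field_derivative_def inner_commute mult.commute[of _ "G (x + t *\<^sub>R a) \<bullet> a"] mult_commute_abs)
qed

lemma C1_mean_value:
  assumes w: "C1_with_gradient S w G" and "0 < t" and S: "\<And>s. 0 < s \<Longrightarrow> s < t \<Longrightarrow> x + s *\<^sub>R a \<in> S"
  obtains s where "0 < s" "s < t" "w (x + t *\<^sub>R a) - w x = t * (G (x + s *\<^sub>R a) \<bullet> a)"
proof -
  have img: "(\<lambda>s. x + s *\<^sub>R a) ` {0..t} \<subseteq> closure S"
  proof -
    have c: "continuous_on (closure {0<..<t}) (\<lambda>s. x + s *\<^sub>R a)"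
      by (intro continuous_intros)
    have "(\<lambda>s. x + s *\<^sub>R a) ` closure {0<..<t} \<subseteq> closure S"
      using S closure_subset[of S] by (intro image_closure_subset[OF c]) auto
    then show ?thesis using \<open>0 < t\<close> by simp
  qed
  have "continuous_on {0..t} (\<lambda>s. w (x + s *\<^sub>R a))"
    by (rule continuous_on_compose2[OF C1_with_gradientD(1)[OF w] _ img]) (intro continuous_intros)
  from mvt[OF \<open>0 < t\<close> this, of "\<lambda>s h. (G (x + s *\<^sub>R a) \<bullet> a) * h"]
  obtain s where "0 < s" "s < t" "w (x + t *\<^sub>R a) - w (x + 0 *\<^sub>R a) = (G (x + s *\<^sub>R a) \<bullet> a) * (t - 0)"
    using C1_segment_derivative[OF w S] by (auto simp: has_field_derivative_def)
  then show ?thesis using that by (simp add: mult.commute)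
qed

text \<open>Schwarz's theorem for functions given by their gradient: the second difference of \<open>u\<close> over a small
parallelogram with sides \<open>t a\<close> and \<open>t b\<close> equals \<open>t\<^sup>2\<close> times either mixed derivative at some point
nearby, by the mean value theorem applied in both orders.\<close>

lemma symmetric_second_gradient:
  assumes "open S" "x \<in> S" and u: "C1_with_gradient S u G"
    and a: "C1_with_gradient S (\<lambda>y. G y \<bullet> a) A" and b: "C1_with_gradient S (\<lambda>y. G y \<bullet> b) B"
  shows "A x \<bullet> b = B x \<bullet> a"
proof (rule ccontr)
  assume neq: "A x \<bullet> b \<noteq> B x \<bullet> a"
  define e where "e = \<bar>A x \<bullet> b - B x \<bullet> a\<bar> / 2"
  have "e > 0" using neq by (simp add: e_def)
  have near: "\<exists>d>0. \<forall>y. dist y x < d \<longrightarrow> y \<in> S \<and> \<bar>A y \<bullet> b - A x \<bullet> b\<bar> < e \<and> \<bar>B y \<bullet> a - B x \<bullet> a\<bar> < e"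
  proof -
    have "continuous_on S A" "continuous_on S B"
      using C1_with_gradientD(2)[OF a] C1_with_gradientD(2)[OF b] closure_subset continuous_on_subset by blast+
    then have "isCont (\<lambda>y. A y \<bullet> b) x" "isCont (\<lambda>y. B y \<bullet> a) x"
      using assms(1,2) by (auto simp: continuous_on_eq_continuous_at intro!: continuous_intros)
    then have "\<forall>\<^sub>F y in nhds x. \<bar>A y \<bullet> b - A x \<bullet> b\<bar> < e" "\<forall>\<^sub>F y in nhds x. \<bar>B y \<bullet> a - B x \<bullet> a\<bar> < e"
      using tendstoD[OF _ \<open>e > 0\<close>] unfolding isCont_def
        tendsto_at_iff_tendsto_nhds[of "\<lambda>y. A y \<bullet> b"] tendsto_at_iff_tendsto_nhds[of "\<lambda>y. B y \<bullet> a"]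
      by (fastforce simp: dist_real_def)+
    moreover have "\<forall>\<^sub>F y in nhds x. y \<in> S"
      using assms(1,2) by (simp add: eventually_nhds_in_open)
    ultimately have "\<forall>\<^sub>F y in nhds x. y \<in> S \<and> \<bar>A y \<bullet> b - A x \<bullet> b\<bar> < e \<and> \<bar>B y \<bullet> a - B x \<bullet> a\<bar> < e"
      by eventually_elim auto
    then show ?thesis by (simp add: eventually_nhds_metric)
  qed
  then obtain d where d: "d > 0" "\<And>y. dist y x < d \<Longrightarrow> y \<in> S"
      "\<And>y. dist y x < d \<Longrightarrow> \<bar>A y \<bullet> b - A x \<bullet> b\<bar> < e" "\<And>y. dist y x < d \<Longrightarrow> \<bar>B y \<bullet> a - B x \<bullet> a\<bar> < e"
    by blast
  define t where "t = d / (2 * (norm a + norm b + 1))"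
  have n0: "norm a + norm b + 1 > 0" by (smt (verit) norm_ge_zero)
  have "t > 0" using d n0 by (simp add: t_def)
  have close: "dist (x + s *\<^sub>R p + r *\<^sub>R q) x < d"
    if "0 \<le> s" "s \<le> t" "0 \<le> r" "r \<le> t" "norm p + norm q \<le> norm a + norm b" for s r p q
  proof -
    have "dist (x + s *\<^sub>R p + r *\<^sub>R q) x = norm (s *\<^sub>R p + r *\<^sub>R q)" by (simp add: dist_norm)
    also have "\<dots> \<le> s * norm p + r * norm q" using that by (intro norm_triangle_le) simp
    also have "\<dots> \<le> t * norm p + t * norm q" using that by (intro add_mono mult_right_mono) auto
    also have "\<dots> \<le> t * (norm a + norm b)"
      using mult_left_mono[OF that(5), of t] \<open>t > 0\<close> by (simp add: algebra_simps)
    also have "\<dots> < d" using d n0 by (simp add: t_def field_simps) (smt (verit) mult_nonneg_nonneg norm_ge_zero)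
    finally show ?thesis .
  qed
  \<comment> \<open>The second difference over a small parallelogram, read in both orders.\<close>
  have rect: "\<exists>y. dist y x < d \<and> u (x + t *\<^sub>R p + t *\<^sub>R q) - u (x + t *\<^sub>R p) - u (x + t *\<^sub>R q) + u x = t * (t * (P y \<bullet> q))"
    if P: "C1_with_gradient S (\<lambda>y. G y \<bullet> p) P" and n: "norm p + norm q \<le> norm a + norm b" for p q P
  proof -
    let ?f = "\<lambda>s. u ((x + t *\<^sub>R q) + s *\<^sub>R p) - u (x + s *\<^sub>R p)"
    have i1: "(x + t *\<^sub>R q) + s *\<^sub>R p \<in> S" if "0 \<le> s" "s \<le> t" for s
      using close[of t s q p] d(2) that \<open>t > 0\<close> n by (simp add: add.commute)
    have i2: "x + s *\<^sub>R p \<in> S" if "0 \<le> s" "s \<le> t" for s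
      using close[of s 0 p q] d(2) that \<open>t > 0\<close> n by simp
    have der: "(?f has_real_derivative (G ((x + t *\<^sub>R q) + s *\<^sub>R p) \<bullet> p - G (x + s *\<^sub>R p) \<bullet> p)) (at s)"
      if "0 \<le> s" "s \<le> t" for s
      by (intro DERIV_diff C1_segment_derivative[OF u] i1 i2 that)
    obtain s where s: "0 < s" "s < t" "?f t - ?f 0 = (t - 0) * (G ((x + t *\<^sub>R q) + s *\<^sub>R p) \<bullet> p - G (x + s *\<^sub>R p) \<bullet> p)"
      using MVT2[OF \<open>t > 0\<close> der] by auto
    have "x + s *\<^sub>R p + r *\<^sub>R q \<in> S" if "0 < r" "r < t" for r
      using close[of s r p q] d(2) that s n by simp
    then obtain r where r: "0 < r" "r < t"
      "G (x + s *\<^sub>R p + t *\<^sub>R q) \<bullet> p - G (x + s *\<^sub>R p) \<bullet> p = t * (P (x + s *\<^sub>R p + r *\<^sub>R q) \<bullet> q)"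
      using C1_mean_value[OF P \<open>t > 0\<close>, of "x + s *\<^sub>R p" q] by blast
    have "dist (x + s *\<^sub>R p + r *\<^sub>R q) x < d" using close[of s r p q] r s n by simp
    moreover have e: "x + t *\<^sub>R q + s *\<^sub>R p = x + s *\<^sub>R p + t *\<^sub>R q"
        "x + t *\<^sub>R q + t *\<^sub>R p = x + t *\<^sub>R p + t *\<^sub>R q"
      by (simp_all add: algebra_simps)
    have "u (x + t *\<^sub>R p + t *\<^sub>R q) - u (x + t *\<^sub>R p) - u (x + t *\<^sub>R q) + u x
        = t * (t * (P (x + s *\<^sub>R p + r *\<^sub>R q) \<bullet> q))"
      using s(3) unfolding e r(3) by simp
    ultimately show ?thesis by blast
  qed
  obtain y where y: "dist y x < d"
    "u (x + t *\<^sub>R a + t *\<^sub>R b) - u (x + t *\<^sub>R a) - u (x + t *\<^sub>R b) + u x = t * (t * (A y \<bullet> b))"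
    using rect[OF a] by auto
  obtain z where z: "dist z x < d"
    "u (x + t *\<^sub>R b + t *\<^sub>R a) - u (x + t *\<^sub>R b) - u (x + t *\<^sub>R a) + u x = t * (t * (B z \<bullet> a))"
    using rect[OF b, of a] by auto
  have e2: "x + t *\<^sub>R b + t *\<^sub>R a = x + t *\<^sub>R a + t *\<^sub>R b" by (simp add: algebra_simps)
  have "t * (t * (A y \<bullet> b)) = t * (t * (B z \<bullet> a))"
    using y(2) z(2)[unfolded e2] by linarith
  then have "A y \<bullet> b = B z \<bullet> a" using \<open>t > 0\<close> by simp
  then show False using d(3)[OF y(1)] d(4)[OF z(1)] unfolding e_def by (simp add: abs_if split: if_splits)
qed

section \<open>The divergence theorem for fields that vanish on the boundary\<close>

lemma lborel_translation:
  fixes f :: "'a::euclidean_space \<Rightarrow> real"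
  assumes "integrable lborel f"
  shows "integrable lborel (\<lambda>x. f (x + c))" "(LINT x|lborel. f (x + c)) = (LINT x|lborel. f x)"
proof -
  have m: "(+) c \<in> lborel \<rightarrow>\<^sub>M borel" by simp
  have f: "f \<in> borel_measurable borel" using assms by (simp add: borel_measurable_integrable)
  have "integrable (distr lborel borel ((+) c)) f" using assms by (simp add: lborel_distr_plus)
  then show "integrable lborel (\<lambda>x. f (x + c))"
    using integrable_distr_eq[OF m f] by (simp add: add.commute)
  have "(LINT x|lborel. f x) = (LINT x|distr lborel borel ((+) c). f x)" by (simp add: lborel_distr_plus)
  also have "\<dots> = (LINT x|lborel. f (x + c))" using integral_distr[OF m f] by (simp add: add.commute)
  finally show "(LINT x|lborel. f (x + c)) = (LINT x|lborel. f x)" by simp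
qed

text \<open>All integrals are taken over such a set. A null frontier is all the regularity of the boundary
that integration by parts needs for functions that vanish there.\<close>

locale null_frontier_domain =
  fixes \<Omega> :: "'a::euclidean_space set"
  assumes open_dom: "open \<Omega>" and bounded_dom: "bounded \<Omega>" and null_frontier: "negligible (frontier \<Omega>)"
begin

lemma compact_closure_dom: "compact (closure \<Omega>)"
  using bounded_dom by (simp add: compact_closure)

lemma in_closure [intro]: "x \<in> \<Omega> \<Longrightarrow> x \<in> closure \<Omega>"
  using closure_subset by blast

lemma set_integrable_closure:
  fixes f :: "'a \<Rightarrow> real"
  assumes "continuous_on (closure \<Omega>) f"
  shows "set_integrable lborel \<Omega> f"
proof (rule set_integrable_subset)
  show "set_integrable lborel (closure \<Omega>) f"
    using borel_integrable_compact[OF compact_closure_dom assms] by (simp add: set_integrable_def)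
qed (use open_dom closure_subset in auto)

lemma integrable_closure:
  fixes f :: "'a \<Rightarrow> real"
  assumes "continuous_on (closure \<Omega>) f"
  shows "f integrable_on \<Omega>"
  using set_borel_integral_eq_integral(1)[OF set_integrable_closure[OF assms]] .

lemma bounded_closure:
  fixes f :: "'a \<Rightarrow> 'b::real_normed_vector"
  assumes "continuous_on (closure \<Omega>) f"
  obtains L where "L > 0" "\<And>x. x \<in> closure \<Omega> \<Longrightarrow> norm (f x) \<le> L"
  using compact_imp_bounded[OF compact_continuous_image[OF assms compact_closure_dom]]
  unfolding bounded_pos by auto

text \<open>The segment from \<open>x\<close> to \<open>y\<close> leaves the domain at a first point, where \<open>w\<close> is 0; before it, the
mean value theorem applies.\<close>

lemma distance_bound_from_zero_frontier:
  assumes w: "C1_with_gradient \<Omega> w G" and fr: "\<And>x. x \<in> frontier \<Omega> \<Longrightarrow> w x = 0"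
    and L: "\<And>x. x \<in> \<Omega> \<Longrightarrow> norm (G x) \<le> L" and xy: "x \<in> \<Omega>" "y \<notin> \<Omega>"
  shows "\<bar>w x\<bar> \<le> L * dist x y"
proof -
  let ?K = "{s. 0 \<le> s \<and> x + s *\<^sub>R (y - x) \<notin> \<Omega>}"
  have cl: "closed ?K"
  proof -
    have "closed ((\<lambda>s. x + s *\<^sub>R (y - x)) -` (- \<Omega>))"
      using open_dom by (intro closed_vimage continuous_intros) auto
    moreover have "?K = {0..} \<inter> ((\<lambda>s. x + s *\<^sub>R (y - x)) -` (- \<Omega>))" by auto
    ultimately show ?thesis by (metis closed_Int closed_atLeast)
  qed
  have ne: "1 \<in> ?K" using xy by simp
  have bdd: "bdd_below ?K" by (auto intro: bdd_belowI[of _ 0])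
  \<comment> \<open>The first parameter at which the segment from \<open>x\<close> to \<open>y\<close> leaves the domain.\<close>
  define t where "t = Inf ?K"
  have tK: "t \<in> ?K" unfolding t_def using closed_contains_Inf[OF _ bdd cl] ne by blast
  have t1: "t \<le> 1" unfolding t_def by (rule cInf_lower[OF ne bdd])
  have t0: "0 < t" using tK xy by (cases "t = 0") auto
  have ins: "x + s *\<^sub>R (y - x) \<in> \<Omega>" if "0 \<le> s" "s < t" for s
    using cInf_lower[OF _ bdd, of s] that unfolding t_def by force
  let ?p = "x + t *\<^sub>R (y - x)"
  have "?p \<in> closure \<Omega>"
  proof -
    have "(\<lambda>s. x + s *\<^sub>R (y - x)) ` closure {0<..<t} \<subseteq> closure \<Omega>"
      using ins by (intro image_closure_subset continuous_intros) auto
    then show ?thesis using t0 by (simp add: image_subset_iff)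
  qed
  then have "w ?p = 0" using tK open_dom fr by (auto simp: frontier_def interior_open)
  obtain s where s: "0 < s" "s < t" "w ?p - w x = t * (G (x + s *\<^sub>R (y - x)) \<bullet> (y - x))"
    using C1_mean_value[OF w t0, of x "y - x"] ins by auto
  have "w x = - (t * (G (x + s *\<^sub>R (y - x)) \<bullet> (y - x)))"
    using s(3) \<open>w ?p = 0\<close> by linarith
  then have "\<bar>w x\<bar> = t * \<bar>G (x + s *\<^sub>R (y - x)) \<bullet> (y - x)\<bar>"
    using t0 by (simp only: abs_minus_cancel abs_mult abs_of_pos)
  also have "\<dots> \<le> 1 * (L * norm (y - x))"
  proof (rule mult_mono[OF t1])
    show "\<bar>G (x + s *\<^sub>R (y - x)) \<bullet> (y - x)\<bar> \<le> L * norm (y - x)"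
      using s by (intro order_trans[OF Cauchy_Schwarz_ineq2 mult_right_mono[OF L[OF ins]]]) auto
  qed auto
  finally show ?thesis by (simp add: dist_norm norm_minus_commute)
qed

text \<open>If the segment between the points stays in the domain, the mean value theorem gives the bound.
Otherwise each of the two values is bounded by the distance to a point of the segment outside the
domain, which accounts for the factor 2.\<close>

lemma zero_extension_Lipschitz:
  assumes w: "C1_with_gradient \<Omega> w G" and fr: "\<And>x. x \<in> frontier \<Omega> \<Longrightarrow> w x = 0"
    and L: "\<And>x. x \<in> \<Omega> \<Longrightarrow> norm (G x) \<le> L"
    and "0 \<le> L"
  shows "\<bar>(if y \<in> \<Omega> then w y else 0) - (if x \<in> \<Omega> then w x else 0)\<bar> \<le> 2 * L * dist x y"
proof (cases "\<exists>s. 0 \<le> s \<and> s \<le> 1 \<and> x + s *\<^sub>R (y - x) \<notin> \<Omega>")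
  case True
  then obtain s where s: "0 \<le> s" "s \<le> 1" "x + s *\<^sub>R (y - x) \<notin> \<Omega>" by blast
  let ?p = "x + s *\<^sub>R (y - x)"
  have d: "dist x ?p \<le> dist x y" "dist y ?p \<le> dist x y"
  proof -
    have "y - ?p = (1 - s) *\<^sub>R (y - x)" by (simp add: algebra_simps)
    then have "dist y ?p = (1 - s) * norm (y - x)" using s by (simp add: dist_norm)
    then show "dist y ?p \<le> dist x y" using s
      by (simp add: dist_norm norm_minus_commute mult_left_le_one_le)
    show "dist x ?p \<le> dist x y" using s by (simp add: dist_norm norm_minus_commute mult_left_le_one_le)
  qed
  have "\<bar>if z \<in> \<Omega> then w z else 0\<bar> \<le> L * dist x y" if "z = x \<or> z = y" for z
  proof (cases "z \<in> \<Omega>")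
    case True
    have "\<bar>w z\<bar> \<le> L * dist z ?p"
      by (rule distance_bound_from_zero_frontier[OF w fr L True s(3)])
    also have "\<dots> \<le> L * dist x y" using d that \<open>0 \<le> L\<close> by (intro mult_left_mono) auto
    finally show ?thesis using True by simp
  next
    case False
    then show ?thesis using \<open>0 \<le> L\<close> by simp
  qed
  note this[OF disjI1[OF refl]] this[OF disjI2[OF refl]]
  then show ?thesis by linarith
next
  case False
  then have ins: "x + s *\<^sub>R (y - x) \<in> \<Omega>" if "0 \<le> s" "s \<le> 1" for s using that by auto
  obtain s where s: "0 < s" "s < 1" "w (x + 1 *\<^sub>R (y - x)) - w x = 1 * (G (x + s *\<^sub>R (y - x)) \<bullet> (y - x))"
    using C1_mean_value[OF w zero_less_one, of x "y - x"] ins by auto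
  have "\<bar>w y - w x\<bar> \<le> L * norm (y - x)"
    using s Cauchy_Schwarz_ineq2[of "G (x + s *\<^sub>R (y - x))" "y - x"]
      mult_right_mono[OF L[OF ins[of s]], of "norm (y - x)"] by simp
  moreover have "x \<in> \<Omega>" "y \<in> \<Omega>" using ins[of 0] ins[of 1] by auto
  ultimately show ?thesis
    using mult_nonneg_nonneg[OF \<open>0 \<le> L\<close> norm_ge_zero[of "y - x"]] by (simp add: dist_norm norm_minus_commute)
qed

text \<open>The extension \<open>f\<close> of \<open>w\<close> by 0 is Lipschitz. Its difference quotients in the direction \<open>b\<close> have
integral 0 because Lebesgue measure is invariant under translations, they are uniformly bounded with
bounded support, and off the frontier they converge to \<open>G x \<bullet> b\<close> inside the domain and to 0 outside.
Dominated convergence concludes.\<close>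

theorem integral_gradient_zero:
  assumes w: "C1_with_gradient \<Omega> w G" and fr: "\<And>x. x \<in> frontier \<Omega> \<Longrightarrow> w x = 0"
  shows "integral \<Omega> (\<lambda>x. G x \<bullet> b) = 0"
proof -
  obtain L where L: "L > 0" "\<And>x. x \<in> closure \<Omega> \<Longrightarrow> norm (G x) \<le> L"
    using bounded_closure[OF C1_with_gradientD(2)[OF w]] by blast
  define f where "f = (\<lambda>x. if x \<in> \<Omega> then w x else 0)"
  define t where "t = (\<lambda>n. 1 / real (Suc n))"
  have t: "t n > 0" "t n \<le> 1" for n by (auto simp: t_def)
  have t_lim: "t \<longlonglongrightarrow> 0" unfolding t_def using LIMSEQ_inverse_real_of_nat by (simp add: inverse_eq_divide)
  define q where "q = (\<lambda>n x. (f (x + t n *\<^sub>R b) - f x) / t n)"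
  have f_int: "integrable lborel f"
  proof -
    have "f = (\<lambda>x. indicator \<Omega> x *\<^sub>R w x)" by (auto simp: f_def)
    then show ?thesis
      using set_integrable_closure[OF C1_with_gradientD(1)[OF w]] by (simp add: set_integrable_def)
  qed
  have q_lint: "integrable lborel (q n)" for n
    unfolding q_def using lborel_translation(1)[OF f_int] f_int
    by (intro integrable_divide Bochner_Integration.integrable_diff) auto
  have q_int: "q n integrable_on UNIV" "integral UNIV (q n) = 0" for n
  proof -
    show "q n integrable_on UNIV" using q_lint integrable_on_lborel by blast
    show "integral UNIV (q n) = 0"
      unfolding integral_lborel[OF q_lint] unfolding q_def
      using lborel_translation[OF f_int] f_int by simp
  qed
  obtain M where M: "\<And>x. x \<in> \<Omega> \<Longrightarrow> norm x \<le> M" using bounded_dom bounded_iff by blast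
  define B where "B = cball (0::'a) (M + norm b)"
  define h where "h = (\<lambda>x. if x \<in> B then 2 * L * norm b else 0)"
  have "(\<lambda>x::'a. 2 * L * norm b) integrable_on B"
    unfolding B_def by (intro integrable_on_const) simp
  then have h_int: "h integrable_on UNIV"
    unfolding h_def by (simp add: integrable_restrict_UNIV)
  have q_le: "norm (q n x) \<le> h x" for n x
  proof (cases "x \<in> B")
    case True
    have "\<bar>f (x + t n *\<^sub>R b) - f x\<bar> \<le> 2 * L * dist x (x + t n *\<^sub>R b)"
      unfolding f_def
    proof (rule zero_extension_Lipschitz[OF w fr])
      show "norm (G y) \<le> L" if "y \<in> \<Omega>" for y using that L(2) by blast
    qed (use L(1) in simp_all)
    also have "\<dots> = 2 * L * norm b * t n" using t(1)[of n] by (simp add: dist_norm)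
    finally show ?thesis using True t[of n] by (simp add: q_def h_def divide_le_eq)
  next
    case False
    have "x \<notin> \<Omega>" "x + t n *\<^sub>R b \<notin> \<Omega>"
    proof -
      show "x \<notin> \<Omega>" using False M[of x] norm_ge_zero[of b] by (force simp: B_def)
      show "x + t n *\<^sub>R b \<notin> \<Omega>"
      proof
        assume "x + t n *\<^sub>R b \<in> \<Omega>"
        then have "norm (x + t n *\<^sub>R b) \<le> M" by (rule M)
        moreover have "norm x \<le> norm (x + t n *\<^sub>R b) + norm (t n *\<^sub>R b)"
          using norm_triangle_ineq4[of "x + t n *\<^sub>R b" "t n *\<^sub>R b"] by simp
        moreover have "norm (t n *\<^sub>R b) \<le> norm b" using t[of n] by (simp add: mult_left_le_one_le)
        ultimately show False using False by (simp add: B_def)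
      qed
    qed
    then show ?thesis using False by (simp add: q_def f_def h_def)
  qed
  define g where "g = (\<lambda>x. if x \<in> \<Omega> then G x \<bullet> b else 0)"
  have q_lim: "(\<lambda>n. q n x) \<longlonglongrightarrow> g x" if "x \<notin> frontier \<Omega>" for x
  proof -
    have tb: "(\<lambda>n. x + t n *\<^sub>R b) \<longlonglongrightarrow> x"
      using tendsto_add[OF tendsto_const tendsto_scaleR[OF t_lim tendsto_const], of x b] by simp
    show ?thesis
    proof (cases "x \<in> \<Omega>")
      case True
      have "((\<lambda>s. w (x + s *\<^sub>R b)) has_real_derivative (G (x + 0 *\<^sub>R b) \<bullet> b)) (at 0)"
        using True by (intro C1_segment_derivative[OF w]) simp
      then have "((\<lambda>s. (w (x + s *\<^sub>R b) - w x) / s) \<longlongrightarrow> G x \<bullet> b) (at 0)"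
        by (simp add: has_field_derivative_iff)
      moreover have "filterlim t (at 0) sequentially"
        using t_lim t by (auto simp: filterlim_at intro!: always_eventually less_imp_neq[symmetric])
      ultimately have "(\<lambda>n. (w (x + t n *\<^sub>R b) - w x) / t n) \<longlonglongrightarrow> G x \<bullet> b"
        by (rule filterlim_compose)
      moreover have "\<forall>\<^sub>F n in sequentially. x + t n *\<^sub>R b \<in> \<Omega>"
        using topological_tendstoD[OF tb open_dom True] .
      then have "\<forall>\<^sub>F n in sequentially. (w (x + t n *\<^sub>R b) - w x) / t n = q n x"
        by eventually_elim (use True in \<open>simp add: q_def f_def\<close>)
      ultimately show ?thesis
        using True Lim_transform_eventually by (fastforce simp: g_def)
    next
      case False
      then have "x \<in> - closure \<Omega>" using that open_dom by (simp add: frontier_def interior_open)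
      then have "\<forall>\<^sub>F n in sequentially. x + t n *\<^sub>R b \<in> - closure \<Omega>"
        by (intro topological_tendstoD[OF tb]) auto
      then have "\<forall>\<^sub>F n in sequentially. 0 = q n x"
        by eventually_elim (use False in \<open>auto simp: q_def f_def\<close>)
      then have "(\<lambda>n. q n x) \<longlonglongrightarrow> 0" by (rule Lim_transform_eventually[OF tendsto_const])
      then show ?thesis using False by (simp add: g_def)
    qed
  qed
  have spike: "integral (UNIV - frontier \<Omega>) k = integral UNIV k" for k :: "'a \<Rightarrow> real"
    using null_frontier by (intro integral_spike_set) (auto intro: negligible_subset)
  have spike_int: "k integrable_on (UNIV - frontier \<Omega>)" if "k integrable_on UNIV" for k :: "'a \<Rightarrow> real"
    using null_frontier by (intro integrable_spike_set[OF that]) (auto intro: negligible_subset)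
  have "(\<lambda>n. integral (UNIV - frontier \<Omega>) (q n)) \<longlonglongrightarrow> integral (UNIV - frontier \<Omega>) g"
    by (rule dominated_convergence(2)[of q _ h]) (use q_int h_int q_le q_lim in \<open>auto intro: spike_int\<close>)
  then have "(\<lambda>n. 0) \<longlonglongrightarrow> integral UNIV g"
    by (simp add: spike q_int)
  then have "integral UNIV g = 0" using LIMSEQ_unique tendsto_const by blast
  then show ?thesis unfolding g_def by (simp add: integral_restrict_UNIV)
qed

end

section \<open>Second derivatives and the geometry of the boundary\<close>

text \<open>The second derivatives are kept as the gradients \<open>H b\<close> of the partial derivatives \<open>G x \<bullet> b\<close>, so that
every fact about \<open>C1_with_gradient\<close> applies to them.\<close>

definition C2_with_derivatives ::
  "'a::euclidean_space set \<Rightarrow> ('a \<Rightarrow> real) \<Rightarrow> ('a \<Rightarrow> 'a) \<Rightarrow> ('a \<Rightarrow> 'a \<Rightarrow> 'a) \<Rightarrow> bool" where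
  "C2_with_derivatives S u G H \<longleftrightarrow>
     C1_with_gradient S u G \<and> (\<forall>b\<in>Basis. C1_with_gradient S (\<lambda>x. G x \<bullet> b) (H b))"

lemma Ck_closure_Suc_gradient:
  assumes f: "Ck_closure (Suc k) S f"
  obtains g where "\<And>b. b \<in> Basis \<Longrightarrow> Ck_closure k S (g b)"
    "\<And>b x. b \<in> Basis \<Longrightarrow> x \<in> S \<Longrightarrow> g b x = frechet_derivative f (at x) b"
    "C1_with_gradient S f (\<lambda>x. \<Sum>b\<in>Basis. g b x *\<^sub>R b)"
proof -
  obtain g where g: "\<And>b. b \<in> Basis \<Longrightarrow> Ck_closure k S (g b)"
    "\<And>b x. b \<in> Basis \<Longrightarrow> x \<in> S \<Longrightarrow> g b x = frechet_derivative f (at x) b"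
    using f by simp metis
  have cont: "continuous_on (closure S) (g b)" if "b \<in> Basis" for b
    using g(1)[OF that] by (cases k) auto
  have der: "GDERIV f x :> (\<Sum>b\<in>Basis. g b x *\<^sub>R b)" if "x \<in> S" for x
  proof -
    have d: "(f has_derivative frechet_derivative f (at x)) (at x)"
      using f that by (simp add: frechet_derivative_works)
    have "frechet_derivative f (at x) h = h \<bullet> (\<Sum>b\<in>Basis. g b x *\<^sub>R b)" for h
    proof -
      have lin: "linear (frechet_derivative f (at x))"
        using d has_derivative_linear by blast
      have "frechet_derivative f (at x) h = frechet_derivative f (at x) (\<Sum>b\<in>Basis. (h \<bullet> b) *\<^sub>R b)"
        by (simp add: euclidean_representation)
      also have "\<dots> = (\<Sum>b\<in>Basis. (h \<bullet> b) * g b x)"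
        using lin that g(2) by (simp add: linear_sum linear_cmul)
      finally show ?thesis by (simp add: inner_sum_right mult.commute)
    qed
    then have "frechet_derivative f (at x) = (\<lambda>h. h \<bullet> (\<Sum>b\<in>Basis. g b x *\<^sub>R b))" by blast
    then show ?thesis using d by (simp add: gderiv_def)
  qed
  have "C1_with_gradient S f (\<lambda>x. \<Sum>b\<in>Basis. g b x *\<^sub>R b)"
    using f der cont by (auto simp: C1_with_gradient_def intro!: continuous_intros)
  then show ?thesis using that g by blast
qed

lemma Ck_closure_1_C1:
  assumes "Ck_closure 1 S f"
  obtains G where "C1_with_gradient S f G"
  by (rule Ck_closure_Suc_gradient[OF assms[unfolded One_nat_def]]) (rule that)

lemma Ck_closure_2_C2:
  assumes "open S" "Ck_closure 2 S f"
  obtains G H where "C2_with_derivatives S f G H"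
    "\<And>x. x \<in> S \<Longrightarrow> laplacian f x = (\<Sum>b\<in>Basis. H b x \<bullet> b)"
proof -
  have "Ck_closure (Suc (Suc 0)) S f" using assms(2) by (simp add: numeral_2_eq_2)
  then obtain g where g: "\<And>b. b \<in> Basis \<Longrightarrow> Ck_closure (Suc 0) S (g b)"
    "\<And>b x. b \<in> Basis \<Longrightarrow> x \<in> S \<Longrightarrow> g b x = frechet_derivative f (at x) b"
    "C1_with_gradient S f (\<lambda>x. \<Sum>b\<in>Basis. g b x *\<^sub>R b)"
    using Ck_closure_Suc_gradient by blast
  let ?G = "\<lambda>x. \<Sum>b\<in>Basis. g b x *\<^sub>R b"
  have "\<exists>h. C1_with_gradient S (g b) h" if "b \<in> Basis" for b
    using Ck_closure_1_C1[of S "g b"] g(1)[OF that] unfolding One_nat_def by blast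
  then obtain H where H: "\<And>b. b \<in> Basis \<Longrightarrow> C1_with_gradient S (g b) (H b)" by metis
  have Gb: "(\<lambda>x. ?G x \<bullet> b) = g b" if "b \<in> Basis" for b
    using that by (simp add: inner_sum_left inner_Basis if_distrib sum.delta cong: if_cong)
  have lap: "laplacian f x = (\<Sum>b\<in>Basis. H b x \<bullet> b)" if x: "x \<in> S" for x
    unfolding laplacian_def
  proof (rule sum.cong[OF refl])
    fix b :: 'a assume b: "b \<in> Basis"
    have "((\<lambda>y. frechet_derivative f (at y) b) has_derivative (\<lambda>h. h \<bullet> H b x)) (at x)"
      by (rule has_derivative_transform_within_open[OF C1_with_gradientD(4)[OF H[OF b] x] assms(1) x])
         (use g(2) b in auto)
    then show "frechet_derivative (\<lambda>y. frechet_derivative f (at y) b) (at x) b = H b x \<bullet> b"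
      using frechet_derivative_at by (metis inner_commute)
  qed
  have "C2_with_derivatives S f ?G H"
    unfolding C2_with_derivatives_def using g(3) H Gb by simp
  then show ?thesis using that lap by blast
qed

text \<open>Strictly above the graph are interior points of \<open>S\<close>, strictly below it exterior points.\<close>

lemma graph_frontier:
  assumes \<gamma>: "continuous_on UNIV \<gamma>" and S: "S \<inter> ball x r = {y \<in> ball x r. \<gamma> y < y \<bullet> e}"
    and y: "y \<in> ball x r" "y \<in> frontier S"
  shows "\<gamma> y = y \<bullet> e"
proof (rule ccontr)
  assume "\<gamma> y \<noteq> y \<bullet> e"
  then consider "\<gamma> y < y \<bullet> e" | "y \<bullet> e < \<gamma> y" by linarith
  then show False
  proof cases
    case 1
    have "open ({y. \<gamma> y < y \<bullet> e} \<inter> ball x r)"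
      by (intro open_Int open_ball open_Collect_less \<gamma> continuous_intros)
    moreover have "{y. \<gamma> y < y \<bullet> e} \<inter> ball x r \<subseteq> S" using S by blast
    ultimately have "y \<in> interior S" using 1 y(1) by (auto intro: interiorI)
    then show False using y(2) by (simp add: frontier_def)
  next
    case 2
    have "open ({y. y \<bullet> e < \<gamma> y} \<inter> ball x r)"
      by (intro open_Int open_ball open_Collect_less \<gamma> continuous_intros)
    moreover have "({y. y \<bullet> e < \<gamma> y} \<inter> ball x r) \<inter> S = {}"
    proof -
      have "\<gamma> z < z \<bullet> e" if "z \<in> S" "z \<in> ball x r" for z using S that by blast
      then show ?thesis by fastforce
    qed
    ultimately have "({y. y \<bullet> e < \<gamma> y} \<inter> ball x r) \<inter> closure S = {}"
      by (simp add: open_Int_closure_eq_empty)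
    then show False using 2 y by (auto simp: frontier_def)
  qed
qed

text \<open>Locally the frontier is the image of a hyperplane under the differentiable map
\<open>y \<mapsto> y + \<gamma>(y) e\<close>.\<close>

lemma C1_boundary_negligible_frontier:
  fixes S :: "'a::euclidean_space set"
  assumes "C1_boundary S"
  shows "negligible (frontier S)"
proof (rule locally_negligible_alt[THEN iffD2], rule ballI)
  fix x assume x: "x \<in> frontier S"
  then obtain e \<gamma> where "C1_graph_at S x e \<gamma>" using assms by (auto simp: C1_boundary_def)
  then obtain r where e: "norm e = 1" and \<gamma>: "Ck_closure 1 UNIV \<gamma>" "\<And>y t. \<gamma> (y + t *\<^sub>R e) = \<gamma> y"
    and r: "r > 0" "S \<inter> ball x r = {y \<in> ball x r. \<gamma> y < y \<bullet> e}"
    unfolding C1_graph_at_def by blast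
  obtain \<Gamma> where \<Gamma>: "C1_with_gradient UNIV \<gamma> \<Gamma>" using Ck_closure_1_C1[OF \<gamma>(1)] by blast
  let ?f = "\<lambda>y. y + \<gamma> y *\<^sub>R e"
  have "?f differentiable_on {y. e \<bullet> y = 0}"
    unfolding differentiable_on_def using C1_with_gradientD(4)[OF \<Gamma>]
    by (intro ballI differentiable_add differentiable_scaleR differentiable_const differentiable_ident)
       (auto intro: differentiableI has_derivative_at_withinI)
  then have "negligible (?f ` {y. e \<bullet> y = 0})"
    using e by (intro negligible_differentiable_image_negligible negligible_hyperplane) auto
  moreover have "frontier S \<inter> ball x r \<subseteq> ?f ` {y. e \<bullet> y = 0}"
  proof
    fix y assume y: "y \<in> frontier S \<inter> ball x r"
    have "\<gamma> y = y \<bullet> e"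
      using graph_frontier[of \<gamma> S x r e y] C1_with_gradientD(1)[OF \<Gamma>] r y by simp
    moreover have "\<gamma> (y - (y \<bullet> e) *\<^sub>R e) = \<gamma> y" using \<gamma>(2)[of y "- (y \<bullet> e)"] by simp
    moreover have "e \<bullet> e = 1" using e by (simp add: norm_eq_1)
    ultimately show "y \<in> ?f ` {y. e \<bullet> y = 0}"
      by (intro image_eqI[of _ _ "y - (y \<bullet> e) *\<^sub>R e"]) (auto simp: inner_diff_right inner_commute)
  qed
  ultimately have "negligible (frontier S \<inter> ball x r)" using negligible_subset by blast
  moreover have "openin (top_of_set (frontier S)) (frontier S \<inter> ball x r)" by (simp add: openin_open_Int)
  ultimately show "\<exists>U. openin (top_of_set (frontier S)) U \<and> x \<in> U \<and> negligible U"
    using x r by (intro exI[of _ "frontier S \<inter> ball x r"]) auto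
qed

text \<open>A direction \<open>h\<close> with \<open>h \<bullet> (D - e) < 0\<close> points strictly into \<open>S\<close>. Along it \<open>w\<close> rises from 0 to
nonnegative values, and continuity of the gradient up to the boundary excludes a negative slope at
\<open>x\<close> itself.\<close>

lemma inward_derivative_nonneg:
  assumes graph: "C1_graph_at S x e \<gamma>" and D: "GDERIV \<gamma> x :> D" and x: "x \<in> frontier S"
    and w: "C1_with_gradient S w G" "\<And>y. y \<in> S \<Longrightarrow> 0 \<le> w y" "w x = 0"
    and h: "h \<bullet> (D - e) < 0"
  shows "0 \<le> G x \<bullet> h"
proof (rule ccontr)
  assume "\<not> 0 \<le> G x \<bullet> h"
  then have neg: "0 < - (G x \<bullet> h)" by simp
  obtain r where \<gamma>: "Ck_closure 1 UNIV \<gamma>" and r: "r > 0" "S \<inter> ball x r = {y \<in> ball x r. \<gamma> y < y \<bullet> e}"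
    using graph unfolding C1_graph_at_def by blast
  obtain \<Gamma> where \<Gamma>: "C1_with_gradient UNIV \<gamma> \<Gamma>" using Ck_closure_1_C1[OF \<gamma>] by blast
  have \<gamma>x: "\<gamma> x = x \<bullet> e"
    using graph_frontier[of \<gamma> S x r e x] C1_with_gradientD(1)[OF \<Gamma>] r x by simp
  have "\<Gamma> x = D" by (rule C1_gradient_unique[OF \<Gamma> UNIV_I D])
  have "((\<lambda>t. \<gamma> (x + t *\<^sub>R h) - (x + t *\<^sub>R h) \<bullet> e) has_real_derivative (D \<bullet> h - e \<bullet> h)) (at 0)"
    using C1_segment_derivative[OF \<Gamma>, of x 0 h] C1_segment_derivative[OF C1_linear, of x 0 h UNIV e] \<open>\<Gamma> x = D\<close>
    by (intro DERIV_diff) auto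
  from DERIV_neg_dec_right[OF this] h obtain d where d: "d > 0"
    "\<And>t. 0 < t \<Longrightarrow> t < d \<Longrightarrow> \<gamma> (x + t *\<^sub>R h) < (x + t *\<^sub>R h) \<bullet> e"
    using \<gamma>x by (auto simp: inner_diff_right inner_commute)
  have cl: "x \<in> closure S" using x by (simp add: frontier_def)
  have "continuous_on (closure S) (\<lambda>y. G y \<bullet> h)"
    using C1_with_gradientD(2)[OF w(1)] by (intro continuous_intros)
  then obtain \<delta> where \<delta>: "\<delta> > 0" "\<And>y. y \<in> closure S \<Longrightarrow> dist y x < \<delta> \<Longrightarrow> dist (G y \<bullet> h) (G x \<bullet> h) < - (G x \<bullet> h)"
    using cl neg unfolding continuous_on_iff by meson
  define t where "t = min (d / 2) (min r \<delta> / (2 * (norm h + 1)))"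
  have h1: "norm h + 1 > 0" by (smt (verit) norm_ge_zero)
  have t: "0 < t" "t < d" using d r \<delta> h1 by (auto simp: t_def)
  have small: "norm (s *\<^sub>R h) < min r \<delta>" if "0 < s" "s \<le> t" for s
  proof -
    have "norm (s *\<^sub>R h) \<le> t * (norm h + 1)" using that by (simp add: mult_mono)
    also have "\<dots> \<le> (min r \<delta> / (2 * (norm h + 1))) * (norm h + 1)"
      using h1 by (intro mult_right_mono) (auto simp: t_def)
    also have "\<dots> = min r \<delta> / 2" using h1 by (simp add: field_simps)
    also have "\<dots> < min r \<delta>" using r(1) \<delta>(1) by (simp add: min_def)
    finally show ?thesis .
  qed
  have ins: "x + s *\<^sub>R h \<in> S" if "0 < s" "s \<le> t" for s
  proof -
    have "x + s *\<^sub>R h \<in> ball x r" using small[OF that] by (simp add: dist_norm)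
    then show ?thesis using r(2) d(2)[of s] that t by auto
  qed
  obtain s where s: "0 < s" "s < t" "w (x + t *\<^sub>R h) - w x = t * (G (x + s *\<^sub>R h) \<bullet> h)"
    using C1_mean_value[OF w(1) t(1), of x h] ins by auto
  have "dist (G (x + s *\<^sub>R h) \<bullet> h) (G x \<bullet> h) < - (G x \<bullet> h)"
    using ins[of s] s small[of s] closure_subset by (intro \<delta>(2)) (auto simp: dist_norm)
  then have "G (x + s *\<^sub>R h) \<bullet> h < 0" by (simp add: dist_real_def)
  then have "t * (G (x + s *\<^sub>R h) \<bullet> h) < 0" using t by (simp add: mult_pos_neg)
  then show False using w(2)[OF ins[of t]] w(3) s(3) t by simp
qed

section \<open>Hessians, cut-offs and the flux\<close>

definition hessian_apply :: "('a::euclidean_space \<Rightarrow> 'a \<Rightarrow> 'a) \<Rightarrow> 'a \<Rightarrow> 'a \<Rightarrow> 'a" where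
  "hessian_apply H x a = (\<Sum>b\<in>Basis. (a \<bullet> b) *\<^sub>R H b x)"

definition hessian_trace :: "('a::euclidean_space \<Rightarrow> 'a \<Rightarrow> 'a) \<Rightarrow> 'a \<Rightarrow> real" where
  "hessian_trace H x = (\<Sum>b\<in>Basis. H b x \<bullet> b)"

lemma C2_D:
  assumes "C2_with_derivatives S u G H"
  shows "C1_with_gradient S u G" "\<And>b. b \<in> Basis \<Longrightarrow> C1_with_gradient S (\<lambda>x. G x \<bullet> b) (H b)"
    "continuous_on (closure S) u" "continuous_on (closure S) G" "continuous_on (closure S) (hessian_trace H)"
  using assms unfolding C2_with_derivatives_def hessian_trace_def
  by (auto intro!: continuous_intros dest: C1_with_gradientD)

lemma continuous_on_hessian_apply:
  assumes "C2_with_derivatives S u G H" "continuous_on (closure S) U"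
  shows "continuous_on (closure S) (\<lambda>x. hessian_apply H x (U x))"
  unfolding hessian_apply_def
  using assms(2) C1_with_gradientD(2)[OF C2_D(2)[OF assms(1)]] by (intro continuous_intros) auto

text \<open>Bilinear extension of Schwarz's theorem from basis vectors.\<close>

lemma hessian_apply_symmetric:
  assumes "open S" "x \<in> S" and u: "C2_with_derivatives S u G H"
  shows "hessian_apply H x a \<bullet> c = hessian_apply H x c \<bullet> a"
proof -
  have sym: "H b x \<bullet> d = H d x \<bullet> b" if "b \<in> Basis" "d \<in> Basis" for b d
    using symmetric_second_gradient[OF assms(1,2) C2_D(1)[OF u] C2_D(2)[OF u] C2_D(2)[OF u]] that by blast
  have "hessian_apply H x a \<bullet> c = (\<Sum>b\<in>Basis. \<Sum>d\<in>Basis. (a \<bullet> b) * (c \<bullet> d) * (H b x \<bullet> d))"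
    for a c :: 'a
    unfolding hessian_apply_def inner_sum_left inner_scaleR_left
    by (intro sum.cong refl) (simp add: euclidean_inner[of _ c] sum_distrib_left mult_ac)
  note e = this
  have "hessian_apply H x a \<bullet> c = (\<Sum>d\<in>Basis. \<Sum>b\<in>Basis. (a \<bullet> b) * (c \<bullet> d) * (H b x \<bullet> d))"
    unfolding e by (rule sum.swap)
  also have "\<dots> = (\<Sum>d\<in>Basis. \<Sum>b\<in>Basis. (c \<bullet> d) * (a \<bullet> b) * (H d x \<bullet> b))"
    using sym by (intro sum.cong refl) (auto simp: mult_ac)
  also have "\<dots> = hessian_apply H x c \<bullet> a" unfolding e ..
  finally show ?thesis .
qed

lemma C1_position_dot_gradient:
  assumes "C2_with_derivatives S u G H"
  shows "C1_with_gradient S (\<lambda>x. x \<bullet> G x) (\<lambda>x. hessian_apply H x x + G x)"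
  using C1_inner[of S "\<lambda>x. x" "\<lambda>b _. b" G H] C2_D(2)[OF assms]
  by (simp add: hessian_apply_def euclidean_representation C1_linear)

lemma C1_gradient_dot_gradient:
  assumes "C2_with_derivatives S u G H" "C2_with_derivatives S v K L"
  shows "C1_with_gradient S (\<lambda>x. G x \<bullet> K x) (\<lambda>x. hessian_apply L x (G x) + hessian_apply H x (K x))"
  using C1_inner[of S G H K L] C2_D(2)[OF assms(1)] C2_D(2)[OF assms(2)]
  by (simp add: hessian_apply_def)

lemma gradient_zero_at_minimum:
  assumes "C1_with_gradient S u G" "open S" "x \<in> S" "\<And>y. y \<in> S \<Longrightarrow> u x \<le> u y"
  shows "G x = 0"
proof -
  have "(\<lambda>h. h \<bullet> G x) = (\<lambda>h. 0)"
    using differential_zero_maxmin[OF assms(3,2) C1_with_gradientD(4)[OF assms(1,3)]] assms(4) by blast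
  then show ?thesis by (metis inner_eq_zero_iff)
qed

text \<open>As \<open>n\<close> grows, \<open>cutoff n (u x)\<close> increases to the indicator of \<open>u x > 0\<close>. Composed with a nonnegative
function that vanishes on the boundary it yields an admissible test function, and its derivative is
nonnegative.\<close>

definition cutoff :: "nat \<Rightarrow> real \<Rightarrow> real" where
  "cutoff n s = real n * s / (1 + real n * s)"

lemma cutoff_denominator: "0 \<le> s \<Longrightarrow> 0 < 1 + real n * s"
  by (simp add: add_pos_nonneg)

lemma cutoff_bounds: "0 \<le> s \<Longrightarrow> 0 \<le> cutoff n s" "0 \<le> s \<Longrightarrow> cutoff n s \<le> 1" "cutoff n 0 = 0"
  using cutoff_denominator[of s n] by (auto simp: cutoff_def divide_simps)

lemma cutoff_derivative:
  assumes "0 \<le> s"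
  shows "(cutoff n has_real_derivative (real n / (1 + real n * s)\<^sup>2)) (at s)"
proof -
  have "1 + real n * s > 0" using assms by (simp add: add_pos_nonneg)
  then show ?thesis unfolding cutoff_def
    by (auto intro!: derivative_eq_intros simp: divide_simps power2_eq_square algebra_simps)
qed

lemma cutoff_tendsto:
  assumes "0 < s"
  shows "(\<lambda>n. cutoff n s) \<longlonglongrightarrow> 1"
proof -
  have "(\<lambda>n. 1 / (1 + real n * s)) \<longlonglongrightarrow> 0"
  proof (rule tendsto_divide_0[OF tendsto_const])
    have "filterlim (\<lambda>n. 1 + real n * s) at_top sequentially"
      using assms by (intro filterlim_tendsto_add_at_top[OF tendsto_const]
          filterlim_at_top_mult_tendsto_pos[OF tendsto_const] filterlim_real_sequentially)
    then show "filterlim (\<lambda>n. 1 + real n * s) at_infinity sequentially"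
      by (rule filterlim_at_top_imp_at_infinity)
  qed
  then have "(\<lambda>n. 1 - 1 / (1 + real n * s)) \<longlonglongrightarrow> 1 - 0" by (intro tendsto_intros)
  moreover have "1 - 1 / (1 + real n * s) = cutoff n s" for n
  proof -
    have "1 + real n * s > 0" using assms by (simp add: add_pos_nonneg)
    then show ?thesis by (simp add: cutoff_def field_simps)
  qed
  ultimately show ?thesis by simp
qed

lemma C1_cutoff:
  assumes "C1_with_gradient S u G" "\<And>x. x \<in> closure S \<Longrightarrow> 0 \<le> u x"
  shows "C1_with_gradient S (\<lambda>x. cutoff n (u x)) (\<lambda>x. (real n / (1 + real n * u x)\<^sup>2) *\<^sub>R G x)"
proof (rule C1_compose[OF assms(1), of "{0..}"])
  have "1 + real n * s \<noteq> 0" if "0 \<le> s" for s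
    using cutoff_denominator[OF that, of n] by simp
  then show "continuous_on {0..} (\<lambda>s. real n / (1 + real n * s)\<^sup>2)"
    by (intro continuous_intros) auto
qed (use assms(2) cutoff_derivative in auto)

lemma derivative_square_negative_part:
  "((\<lambda>t. (min t 0)\<^sup>2) has_real_derivative 2 * min t 0) (at t)"
proof -
  consider "t < 0" | "t > 0" | "t = 0" by linarith
  then show ?thesis
  proof cases
    case 1
    have "((\<lambda>t. t\<^sup>2) has_real_derivative 2 * min t 0) (at t)"
      using 1 by (auto intro!: derivative_eq_intros)
    then show ?thesis
      by (rule DERIV_cong_ev[OF refl _ refl, THEN iffD1, rotated])
         (use 1 eventually_nhds_in_open[of "{..<0}" t] in \<open>auto elim!: eventually_mono\<close>)
  next
    case 2
    have "((\<lambda>t. 0) has_real_derivative 2 * min t 0) (at t)"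
      using 2 by (auto intro!: derivative_eq_intros)
    then show ?thesis
      by (rule DERIV_cong_ev[OF refl _ refl, THEN iffD1, rotated])
         (use 2 eventually_nhds_in_open[of "{0<..}" t] in \<open>auto elim!: eventually_mono\<close>)
  next
    case 3
    have "((\<lambda>h::real. (min h 0)\<^sup>2 / h) \<longlongrightarrow> 0) (at 0)"
    proof (rule Lim_null_comparison)
      show "((\<lambda>h::real. \<bar>h\<bar>) \<longlongrightarrow> 0) (at 0)" by (auto intro!: tendsto_eq_intros)
      show "\<forall>\<^sub>F h::real in at 0. norm ((min h 0)\<^sup>2 / h) \<le> \<bar>h\<bar>"
        by (intro always_eventually) (auto simp: min_def power2_eq_square abs_mult)
    qed
    then show ?thesis using 3 by (simp add: has_field_derivative_iff)
  qed
qed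

context null_frontier_domain
begin

lemma integral_divergence_zero:
  assumes W: "\<And>b. b \<in> Basis \<Longrightarrow> C1_with_gradient \<Omega> (W b) (J b)"
    and fr: "\<And>x b. x \<in> frontier \<Omega> \<Longrightarrow> W b x = 0"
  shows "integral \<Omega> (\<lambda>x. \<Sum>b\<in>Basis. J b x \<bullet> b) = 0"
proof -
  have "integral \<Omega> (\<lambda>x. \<Sum>b\<in>Basis. J b x \<bullet> b) = (\<Sum>b\<in>Basis. integral \<Omega> (\<lambda>x. J b x \<bullet> b))"
    using C1_with_gradientD(2)[OF W]
    by (intro integral_sum integrable_closure continuous_intros) auto
  also have "\<dots> = 0" using integral_gradient_zero[OF W fr] by simp
  finally show ?thesis .
qed

text \<open>Passage to the limit in the cut-off. The limit only sees the set where \<open>u > 0\<close>; the hypothesis on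
\<open>k\<close> where \<open>u = 0\<close> covers the rest, since the zero set of \<open>u\<close> may have positive measure.\<close>

lemma integral_nonneg_by_cutoff:
  fixes k u :: "'a \<Rightarrow> real"
  assumes u: "continuous_on (closure \<Omega>) u" "\<And>x. x \<in> closure \<Omega> \<Longrightarrow> 0 \<le> u x"
    and k: "continuous_on (closure \<Omega>) k" "\<And>x. x \<in> \<Omega> \<Longrightarrow> u x = 0 \<Longrightarrow> 0 \<le> k x"
    and n: "\<And>n. 0 \<le> integral \<Omega> (\<lambda>x. cutoff n (u x) * k x)"
  shows "0 \<le> integral \<Omega> k"
proof -
  obtain L where L: "L > 0" "\<And>x. x \<in> closure \<Omega> \<Longrightarrow> norm (k x) \<le> L"
    using bounded_closure[OF k(1)] by blast
  have c: "continuous_on (closure \<Omega>) (\<lambda>x. cutoff n (u x) * k x)" for n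
  proof -
    have "1 + real n * u x \<noteq> 0" if "x \<in> closure \<Omega>" for x
      using cutoff_denominator[OF u(2)[OF that], of n] by simp
    then show ?thesis unfolding cutoff_def using u k by (intro continuous_intros) auto
  qed
  define k0 where "k0 = (\<lambda>x. if u x > 0 then k x else 0)"
  have const: "(\<lambda>x. L) integrable_on \<Omega>" by (intro integrable_closure continuous_intros)
  have bound: "norm (cutoff n (u x) * k x) \<le> L" if "x \<in> \<Omega>" for n x
  proof -
    have "\<bar>cutoff n (u x)\<bar> * \<bar>k x\<bar> \<le> 1 * L"
      using cutoff_bounds(1,2)[of "u x" n] u(2)[OF in_closure[OF that]] L(2)[OF in_closure[OF that]]
      by (intro mult_mono) auto
    then show ?thesis by (simp add: abs_mult)
  qed
  have lim: "(\<lambda>n. cutoff n (u x) * k x) \<longlonglongrightarrow> k0 x" if "x \<in> \<Omega>" for x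
  proof (cases "u x > 0")
    case True
    then show ?thesis
      using tendsto_mult_right[OF cutoff_tendsto[OF True], where c = "k x"] by (simp add: k0_def)
  next
    case False
    then have "u x = 0" using u(2)[OF in_closure[OF that]] by simp
    then show ?thesis by (simp add: k0_def cutoff_bounds)
  qed
  note conv = dominated_convergence[OF integrable_closure[OF c] const bound lim]
  have "0 \<le> integral \<Omega> k0" using conv(2) n by (intro LIMSEQ_le_const) auto
  also have "\<dots> \<le> integral \<Omega> k"
  proof (rule integral_le[OF conv(1) integrable_closure[OF k(1)]])
    show "k0 x \<le> k x" if "x \<in> \<Omega>" for x
      using k(2)[OF that] u(2)[OF in_closure[OF that]] by (auto simp: k0_def)
  qed
  finally show ?thesis .
qed

text \<open>A volume expression for \<open>-\<integral> \<psi> \<partial>u/\<partial>\<nu>\<close> over the boundary, where \<open>G\<close> and \<open>H\<close> are the derivatives of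
\<open>u\<close> and \<open>P\<close> is the gradient of \<open>\<psi>\<close>.\<close>

definition flux :: "('a \<Rightarrow> 'a) \<Rightarrow> ('a \<Rightarrow> 'a \<Rightarrow> 'a) \<Rightarrow> ('a \<Rightarrow> real) \<Rightarrow> ('a \<Rightarrow> 'a) \<Rightarrow> real" where
  "flux G H \<psi> P = integral \<Omega> (\<lambda>x. - hessian_trace H x * \<psi> x - G x \<bullet> P x)"

lemma flux_integrable:
  assumes "C2_with_derivatives \<Omega> u G H" "C1_with_gradient \<Omega> \<psi> P"
  shows "(\<lambda>x. - hessian_trace H x * \<psi> x - G x \<bullet> P x) integrable_on \<Omega>"
  using C2_D[OF assms(1)] C1_with_gradientD[OF assms(2)]
  by (intro integrable_closure continuous_intros) auto

lemma flux_add: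
  assumes "C2_with_derivatives \<Omega> u G H" "C1_with_gradient \<Omega> \<psi> P" "C1_with_gradient \<Omega> \<phi> Q"
  shows "flux G H (\<lambda>x. \<psi> x + \<phi> x) (\<lambda>x. P x + Q x) = flux G H \<psi> P + flux G H \<phi> Q"
  unfolding flux_def
  using Henstock_Kurzweil_Integration.integral_add[OF flux_integrable[OF assms(1,2)] flux_integrable[OF assms(1,3)]]
  by (simp add: algebra_simps inner_add_right)

lemma flux_scale: "flux G H (\<lambda>x. c * \<psi> x) (\<lambda>x. c *\<^sub>R P x) = c * flux G H \<psi> P"
  unfolding flux_def integral_mult_right[symmetric] by (simp add: algebra_simps)

text \<open>The integrand is minus the divergence of \<open>\<psi> \<nabla>u\<close>.\<close>

lemma flux_zero:
  assumes u: "C2_with_derivatives \<Omega> u G H" and \<psi>: "C1_with_gradient \<Omega> \<psi> P"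
    and fr: "\<And>x. x \<in> frontier \<Omega> \<Longrightarrow> \<psi> x = 0 \<or> G x = 0"
  shows "flux G H \<psi> P = 0"
proof -
  have "\<psi> x * (G x \<bullet> b) = 0" if "x \<in> frontier \<Omega>" for x b
    using fr[OF that] by auto
  then have "integral \<Omega> (\<lambda>x. \<Sum>b\<in>Basis. (\<psi> x *\<^sub>R H b x + (G x \<bullet> b) *\<^sub>R P x) \<bullet> b) = 0"
    by (intro integral_divergence_zero[of "\<lambda>b x. \<psi> x * (G x \<bullet> b)"] C1_mult[OF \<psi> C2_D(2)[OF u]])
  moreover have "(\<Sum>b\<in>Basis. (\<psi> x *\<^sub>R H b x + (G x \<bullet> b) *\<^sub>R P x) \<bullet> b)
      = - (- hessian_trace H x * \<psi> x - G x \<bullet> P x)" for x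
    by (simp add: inner_add_left sum.distrib hessian_trace_def sum_distrib_left
        euclidean_inner[of "G x" "P x"] mult.commute[of _ "\<psi> x"])
  ultimately have "integral \<Omega> (\<lambda>x. - (- hessian_trace H x * \<psi> x - G x \<bullet> P x)) = 0" by simp
  then show ?thesis unfolding flux_def integral_neg by simp
qed

text \<open>Since \<open>cutoff n (u x)\<close> vanishes on the frontier, the flux against \<open>cutoff n u * \<psi>\<close> is 0. Expanding the
gradient of this product leaves the cut-off integrand of \<open>flux G H \<psi> P\<close> minus the nonnegative term
\<open>\<psi> c\<^sub>n'(u) |\<nabla>u|\<^sup>2\<close>. Where \<open>u\<close> vanishes inside the domain it has a minimum, so its gradient is 0 and the
integrand is nonnegative there.\<close>

lemma flux_nonneg:
  assumes u: "C2_with_derivatives \<Omega> u G H" "\<And>x. x \<in> closure \<Omega> \<Longrightarrow> 0 \<le> u x"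
      "\<And>x. x \<in> frontier \<Omega> \<Longrightarrow> u x = 0" "\<And>x. x \<in> \<Omega> \<Longrightarrow> hessian_trace H x \<le> 0"
    and \<psi>: "C1_with_gradient \<Omega> \<psi> P" "\<And>x. x \<in> \<Omega> \<Longrightarrow> 0 \<le> \<psi> x"
  shows "0 \<le> flux G H \<psi> P"
  unfolding flux_def
proof (rule integral_nonneg_by_cutoff[OF C2_D(3)[OF u(1)] u(2)])
  show "continuous_on (closure \<Omega>) (\<lambda>x. - hessian_trace H x * \<psi> x - G x \<bullet> P x)"
    using C2_D[OF u(1)] C1_with_gradientD[OF \<psi>(1)] by (intro continuous_intros) auto
  show "0 \<le> - hessian_trace H x * \<psi> x - G x \<bullet> P x" if "x \<in> \<Omega>" "u x = 0" for x
    using gradient_zero_at_minimum[OF C2_D(1)[OF u(1)] open_dom that(1)] u(2) u(4)[OF that(1)] \<psi>(2)[OF that(1)] that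
    by (simp add: in_closure mult_nonpos_nonneg)
  fix n
  let ?d = "\<lambda>x. real n / (1 + real n * u x)\<^sup>2"
  let ?Q = "\<lambda>x. cutoff n (u x) *\<^sub>R P x + \<psi> x *\<^sub>R (?d x *\<^sub>R G x)"
  have Q: "C1_with_gradient \<Omega> (\<lambda>x. cutoff n (u x) * \<psi> x) ?Q"
    by (rule C1_mult[OF C1_cutoff[OF C2_D(1)[OF u(1)] u(2)] \<psi>(1)])
  have "flux G H (\<lambda>x. cutoff n (u x) * \<psi> x) ?Q = 0"
    using u(3) by (intro flux_zero[OF u(1) Q]) (simp add: cutoff_bounds)
  moreover have "- hessian_trace H x * (cutoff n (u x) * \<psi> x) - G x \<bullet> ?Q x
      \<le> cutoff n (u x) * (- hessian_trace H x * \<psi> x - G x \<bullet> P x)" if "x \<in> \<Omega>" for x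
    using \<psi>(2)[OF that] by (simp add: algebra_simps inner_add_right)
  ultimately show "0 \<le> integral \<Omega> (\<lambda>x. cutoff n (u x) * (- hessian_trace H x * \<psi> x - G x \<bullet> P x))"
    unfolding flux_def
    using integral_le[OF flux_integrable[OF u(1) Q] integrable_closure,
        of "\<lambda>x. cutoff n (u x) * (- hessian_trace H x * \<psi> x - G x \<bullet> P x)"]
      C2_D[OF u(1)] C1_with_gradientD[OF \<psi>(1)] C1_with_gradientD(1)[OF C1_cutoff[OF C2_D(1)[OF u(1)] u(2)]]
    by (force intro!: continuous_intros)
qed

text \<open>Only the boundary values of \<open>\<psi>\<close> matter: adding \<open>C min(\<psi>, 0)\<^sup>2\<close>, which vanishes on the frontier,
does not change the flux, and \<open>t + C min(t, 0)\<^sup>2 \<ge> - 1 / (4 C)\<close> for every \<open>t\<close>. Taking \<open>C\<close> large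
makes the test function almost nonnegative in the whole domain.\<close>

lemma flux_nonneg_frontier:
  assumes u: "C2_with_derivatives \<Omega> u G H" "\<And>x. x \<in> closure \<Omega> \<Longrightarrow> 0 \<le> u x"
      "\<And>x. x \<in> frontier \<Omega> \<Longrightarrow> u x = 0" "\<And>x. x \<in> \<Omega> \<Longrightarrow> hessian_trace H x \<le> 0"
    and \<psi>: "C1_with_gradient \<Omega> \<psi> P" "\<And>x. x \<in> frontier \<Omega> \<Longrightarrow> 0 \<le> \<psi> x"
  shows "0 \<le> flux G H \<psi> P"
proof -
  define M where "M = flux G H (\<lambda>x. 1) (\<lambda>x. 0)"
  have "M \<ge> 0" unfolding M_def by (rule flux_nonneg[OF u C1_const]) auto
  have low: "- c * M \<le> flux G H \<psi> P" if "c > 0" for c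
  proof -
    \<comment> \<open>The value for which \<open>t + C t\<^sup>2 + c\<close> is a perfect square.\<close>
    define C where "C = 1 / (4 * c)"
    have N: "C1_with_gradient \<Omega> (\<lambda>x. (min (\<psi> x) 0)\<^sup>2) (\<lambda>x. (2 * min (\<psi> x) 0) *\<^sub>R P x)" (is "C1_with_gradient _ ?n ?N")
      by (rule C1_compose[OF \<psi>(1), of UNIV]) (auto intro!: derivative_square_negative_part continuous_intros)
    have CN: "C1_with_gradient \<Omega> (\<lambda>x. C * ?n x) (\<lambda>x. C *\<^sub>R ?N x)"
      using C1_mult[OF C1_const[of \<Omega> C] N] by simp
    have K: "C1_with_gradient \<Omega> (\<lambda>x. c * 1) (\<lambda>x. c *\<^sub>R 0)" using C1_const[of \<Omega> c] by simp
    have "0 \<le> flux G H (\<lambda>x. \<psi> x + C * ?n x + c * 1) (\<lambda>x. P x + C *\<^sub>R ?N x + c *\<^sub>R 0)"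
    proof (rule flux_nonneg[OF u C1_add[OF C1_add[OF \<psi>(1) CN] K]])
      show "0 \<le> \<psi> x + C * ?n x + c * 1" for x
      proof (cases "\<psi> x < 0")
        case True
        have "\<psi> x + C * (\<psi> x)\<^sup>2 + c = (\<psi> x + 2 * c)\<^sup>2 / (4 * c)"
          using that by (simp add: C_def field_simps power2_eq_square)
        also have "\<dots> \<ge> 0" using that by simp
        finally show ?thesis using True by (simp add: min_def)
      qed (use that in simp)
    qed
    also have "\<dots> = flux G H \<psi> P + C * flux G H ?n ?N + c * M"
      unfolding M_def flux_scale[symmetric]
      by (simp only: flux_add[OF u(1) C1_add[OF \<psi>(1) CN] K] flux_add[OF u(1) \<psi>(1) CN])
    also have "flux G H ?n ?N = 0"
    proof (rule flux_zero[OF u(1) N], rule disjI1)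
      show "(min (\<psi> x) 0)\<^sup>2 = 0" if "x \<in> frontier \<Omega>" for x using \<psi>(2)[OF that] by simp
    qed
    finally show ?thesis by simp
  qed
  show ?thesis
  proof (rule ccontr)
    assume neg: "\<not> 0 \<le> flux G H \<psi> P"
    define c where "c = - flux G H \<psi> P / (2 * (M + 1))"
    have "c > 0" unfolding c_def using neg \<open>M \<ge> 0\<close> by (intro divide_pos_pos) auto
    have "c * M \<le> c * (M + 1)" using \<open>c > 0\<close> by simp
    also have "\<dots> = - flux G H \<psi> P / 2" using \<open>M \<ge> 0\<close> by (simp add: c_def field_simps)
    finally show False using low[OF \<open>c > 0\<close>] neg by simp
  qed
qed



section \<open>The Pohozaev identity\<close>

text \<open>The integrand is the divergence of \<open>Y = (x \<bullet> \<nabla>u) \<nabla>v - (\<nabla>u \<bullet> \<nabla>v) x\<close>. This field is orthogonal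
to \<open>\<nabla>u\<close>, that is, tangential to the level sets of \<open>u\<close> and in particular to the boundary. Hence the
divergence of \<open>c\<^sub>n(u) Y\<close> has no term with a derivative of the cut-off, and the limit
gives the identity. Inside the zero set of \<open>u\<close> the integrand vanishes with \<open>\<nabla>u\<close>.\<close>

lemma tangential_identity:
  assumes u: "C2_with_derivatives \<Omega> u G H" "\<And>x. x \<in> closure \<Omega> \<Longrightarrow> 0 \<le> u x"
      "\<And>x. x \<in> frontier \<Omega> \<Longrightarrow> u x = 0"
    and v: "C2_with_derivatives \<Omega> v K L"
  shows "integral \<Omega> (\<lambda>x. (x \<bullet> G x) * hessian_trace L x + (1 - real DIM('a)) * (G x \<bullet> K x)
           - hessian_apply L x (G x) \<bullet> x) = 0"
proof -
  define A where "A = (\<lambda>x. x \<bullet> G x)"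
  define A' where "A' = (\<lambda>x. hessian_apply H x x + G x)"
  define B where "B = (\<lambda>x. G x \<bullet> K x)"
  define B' where "B' = (\<lambda>x. hessian_apply L x (G x) + hessian_apply H x (K x))"
  have A: "C1_with_gradient \<Omega> A A'" unfolding A_def A'_def by (rule C1_position_dot_gradient[OF u(1)])
  have B: "C1_with_gradient \<Omega> B B'" unfolding B_def B'_def by (rule C1_gradient_dot_gradient[OF u(1) v])
  let ?k = "\<lambda>x. A x * hessian_trace L x + (1 - real DIM('a)) * B x - hessian_apply L x (G x) \<bullet> x"
  have cont: "continuous_on (closure \<Omega>) A" "continuous_on (closure \<Omega>) B" "continuous_on (closure \<Omega>) u"
    "continuous_on (closure \<Omega>) (hessian_trace L)"
    "continuous_on (closure \<Omega>) (\<lambda>x. hessian_apply L x (G x))"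
    using C1_with_gradientD[OF A] C1_with_gradientD[OF B] C2_D[OF u(1)] C2_D[OF v]
      continuous_on_hessian_apply[OF v] by auto
  have k_cont: "continuous_on (closure \<Omega>) ?k"
    using cont by (intro continuous_intros) auto
  have zero: "integral \<Omega> (\<lambda>x. cutoff n (u x) * ?k x) = 0" for n
  proof -
    let ?c = "\<lambda>x. cutoff n (u x)"
    let ?d = "\<lambda>x. real n / (1 + real n * u x)\<^sup>2"
    let ?Y = "\<lambda>b x. A x * (K x \<bullet> b) - B x * (x \<bullet> b)"
    let ?Y' = "\<lambda>b x. (A x *\<^sub>R L b x + (K x \<bullet> b) *\<^sub>R A' x) - (B x *\<^sub>R b + (x \<bullet> b) *\<^sub>R B' x)"
    have W: "C1_with_gradient \<Omega> (\<lambda>x. ?c x * ?Y b x) (\<lambda>x. ?c x *\<^sub>R ?Y' b x + ?Y b x *\<^sub>R (?d x *\<^sub>R G x))"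
      if "b \<in> Basis" for b
      by (intro C1_mult C1_cutoff C2_D(1)[OF u(1)] u(2) C1_diff A B C2_D(2)[OF v that] C1_linear)
    let ?D = "\<lambda>x. \<Sum>b\<in>Basis. (?c x *\<^sub>R ?Y' b x + ?Y b x *\<^sub>R (?d x *\<^sub>R G x)) \<bullet> b"
    have "integral \<Omega> ?D = 0"
      by (rule integral_divergence_zero[OF W]) (simp_all add: u(3) cutoff_bounds)
    moreover have "?D x = ?c x * ?k x"
      if x: "x \<in> \<Omega>" for x
    proof -
      have basis: "(\<Sum>b\<in>Basis. (p \<bullet> b) * (q \<bullet> b)) = p \<bullet> q" for p q :: 'a
        by (rule euclidean_inner[symmetric])
      have "(\<Sum>b\<in>Basis. ?Y' b x \<bullet> b)
          = A x * hessian_trace L x + K x \<bullet> A' x - B x * real DIM('a) - x \<bullet> B' x"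
        by (simp add: inner_diff_left inner_add_left sum.distrib sum_subtractf hessian_trace_def
            sum_distrib_left[symmetric] basis)
      also have "K x \<bullet> A' x = hessian_apply H x (K x) \<bullet> x + B x"
        using hessian_apply_symmetric[OF open_dom x u(1), of x "K x"]
        by (simp add: A'_def B_def inner_add_right inner_commute)
      also have "x \<bullet> B' x = hessian_apply L x (G x) \<bullet> x + hessian_apply H x (K x) \<bullet> x"
        by (simp add: B'_def inner_add_right inner_commute)
      finally have div: "(\<Sum>b\<in>Basis. ?Y' b x \<bullet> b) = ?k x" by (simp add: algebra_simps)
      \<comment> \<open>The field is orthogonal to the gradient of \<open>u\<close>.\<close>
      have "(\<Sum>b\<in>Basis. ?Y b x * (G x \<bullet> b))
          = A x * (\<Sum>b\<in>Basis. (K x \<bullet> b) * (G x \<bullet> b)) - B x * (\<Sum>b\<in>Basis. (x \<bullet> b) * (G x \<bullet> b))"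
        by (simp add: left_diff_distrib sum_subtractf sum_distrib_left mult.assoc)
      also have "\<dots> = 0" unfolding basis by (simp add: A_def B_def inner_commute)
      finally have orth: "(\<Sum>b\<in>Basis. ?Y b x * (G x \<bullet> b)) = 0" .
      have "(\<Sum>b\<in>Basis. (?c x *\<^sub>R ?Y' b x + ?Y b x *\<^sub>R (?d x *\<^sub>R G x)) \<bullet> b)
          = ?c x * (\<Sum>b\<in>Basis. ?Y' b x \<bullet> b) + ?d x * (\<Sum>b\<in>Basis. ?Y b x * (G x \<bullet> b))"
        unfolding sum_distrib_left sum.distrib[symmetric]
        by (intro sum.cong refl) (simp only: inner_add_left inner_scaleR_left mult_ac)
      then show ?thesis unfolding div orth by simp
    qed
    ultimately show ?thesis
      using Henstock_Kurzweil_Integration.integral_cong[of \<Omega> ?D "\<lambda>x. ?c x * ?k x"] by (simp only: )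
  qed
  have crit: "?k x = 0" if "x \<in> \<Omega>" "u x = 0" for x
  proof -
    have "G x = 0"
      using u(2) that by (intro gradient_zero_at_minimum[OF C2_D(1)[OF u(1)] open_dom]) auto
    then show ?thesis by (simp add: A_def B_def hessian_apply_def)
  qed
  have "0 \<le> integral \<Omega> ?k"
    using zero crit by (intro integral_nonneg_by_cutoff[OF cont(3) u(2) k_cont]) auto
  moreover have "0 \<le> integral \<Omega> (\<lambda>x. - ?k x)"
  proof (rule integral_nonneg_by_cutoff[OF cont(3) u(2)])
    show "continuous_on (closure \<Omega>) (\<lambda>x. - ?k x)" by (intro continuous_intros k_cont)
    show "0 \<le> - ?k x" if "x \<in> \<Omega>" "u x = 0" for x using crit[OF that] by simp
    show "0 \<le> integral \<Omega> (\<lambda>x. cutoff n (u x) * - ?k x)" for n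
      unfolding mult_minus_right integral_neg zero by simp
  qed
  ultimately show ?thesis unfolding integral_neg A_def B_def by simp
qed

text \<open>The field \<open>F(u) x\<close> vanishes on the frontier.\<close>

lemma integral_potential:
  assumes u: "C1_with_gradient \<Omega> u G" "\<And>x. x \<in> frontier \<Omega> \<Longrightarrow> u x = 0"
    and F: "\<And>s. (F has_real_derivative f s) (at s)" "F 0 = 0" and f: "continuous_on UNIV f"
  shows "real DIM('a) * integral \<Omega> (\<lambda>x. F (u x)) = - integral \<Omega> (\<lambda>x. f (u x) * (x \<bullet> G x))"
proof -
  have Fu: "C1_with_gradient \<Omega> (\<lambda>x. F (u x)) (\<lambda>x. f (u x) *\<^sub>R G x)"
    by (rule C1_compose[OF u(1), of UNIV]) (use F f in auto)
  have fu: "continuous_on (closure \<Omega>) (\<lambda>x. f (u x))"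
    using continuous_on_compose2[OF f C1_with_gradientD(1)[OF u(1)]] by simp
  have "integral \<Omega> (\<lambda>x. \<Sum>b\<in>Basis. (F (u x) *\<^sub>R b + (x \<bullet> b) *\<^sub>R (f (u x) *\<^sub>R G x)) \<bullet> b) = 0"
    by (rule integral_divergence_zero[OF C1_mult[OF Fu C1_linear]]) (simp add: u(2) F(2))
  moreover have "(\<Sum>b\<in>Basis. (F (u x) *\<^sub>R b + (x \<bullet> b) *\<^sub>R (f (u x) *\<^sub>R G x)) \<bullet> b)
      = real DIM('a) * F (u x) + f (u x) * (x \<bullet> G x)" for x
  proof -
    have "(\<Sum>b\<in>Basis. (x \<bullet> b) * f (u x) * (G x \<bullet> b)) = f (u x) * (\<Sum>b\<in>Basis. (x \<bullet> b) * (G x \<bullet> b))"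
      by (simp add: sum_distrib_left mult_ac)
    then show ?thesis
      by (simp add: inner_add_left sum.distrib euclidean_inner[of x "G x"])
  qed
  moreover have "integral \<Omega> (\<lambda>x. real DIM('a) * F (u x) + f (u x) * (x \<bullet> G x))
      = integral \<Omega> (\<lambda>x. real DIM('a) * F (u x)) + integral \<Omega> (\<lambda>x. f (u x) * (x \<bullet> G x))"
    using fu C1_with_gradientD[OF u(1)] C1_with_gradientD[OF Fu]
    by (intro Henstock_Kurzweil_Integration.integral_add integrable_closure continuous_intros) auto
  ultimately show ?thesis by simp
qed

text \<open>The flux of \<open>v\<close> against \<open>u\<close> is 0 because \<open>u\<close> vanishes on the frontier.\<close>

lemma energy_identity:
  assumes u: "C1_with_gradient \<Omega> u G" "\<And>x. x \<in> frontier \<Omega> \<Longrightarrow> u x = 0"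
    and v: "C2_with_derivatives \<Omega> v K L" and eq: "\<And>x. x \<in> \<Omega> \<Longrightarrow> - hessian_trace L x = f (u x)"
  shows "integral \<Omega> (\<lambda>x. u x * f (u x)) = integral \<Omega> (\<lambda>x. G x \<bullet> K x)"
proof -
  have "integral \<Omega> (\<lambda>x. - hessian_trace L x * u x - K x \<bullet> G x) = 0"
    using flux_zero[OF v u(1)] u(2) unfolding flux_def by simp
  moreover have "integral \<Omega> (\<lambda>x. - hessian_trace L x * u x - K x \<bullet> G x)
     = integral \<Omega> (\<lambda>x. - hessian_trace L x * u x) - integral \<Omega> (\<lambda>x. K x \<bullet> G x)"
    using C1_with_gradientD[OF u(1)] C2_D[OF v]
    by (intro Henstock_Kurzweil_Integration.integral_diff integrable_closure continuous_intros) auto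
  moreover have "integral \<Omega> (\<lambda>x. - hessian_trace L x * u x) = integral \<Omega> (\<lambda>x. u x * f (u x))"
    using eq by (intro Henstock_Kurzweil_Integration.integral_cong) (simp add: mult.commute)
  ultimately show ?thesis by (simp add: inner_commute)
qed

text \<open>Adding the vanishing integral of \<open>tangential_identity\<close> to the flux cancels the two terms that
contain the Hessian of \<open>v\<close>, by its symmetry. What remains are \<open>\<nabla>u \<bullet> \<nabla>v\<close> and the radial
derivatives of the potentials, which \<open>integral_potential\<close> evaluates.\<close>

theorem pohozaev_identity:
  assumes u: "C2_with_derivatives \<Omega> u G H" "\<And>x. x \<in> closure \<Omega> \<Longrightarrow> 0 \<le> u x"
      "\<And>x. x \<in> frontier \<Omega> \<Longrightarrow> u x = 0"
    and v: "C2_with_derivatives \<Omega> v K L" "\<And>x. x \<in> frontier \<Omega> \<Longrightarrow> v x = 0"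
    and eqs: "\<And>x. x \<in> \<Omega> \<Longrightarrow> - hessian_trace L x = f (u x)" "\<And>x. x \<in> \<Omega> \<Longrightarrow> - hessian_trace H x = g (v x)"
    and F: "\<And>s. (F has_real_derivative f s) (at s)" "F 0 = 0" "continuous_on UNIV f"
    and \<Phi>: "\<And>s. (\<Phi> has_real_derivative g s) (at s)" "\<Phi> 0 = 0" "continuous_on UNIV g"
  shows "flux G H (\<lambda>x. - (x \<bullet> K x)) (\<lambda>x. - (hessian_apply L x x + K x))
      = real DIM('a) * (integral \<Omega> (\<lambda>x. F (u x)) + integral \<Omega> (\<lambda>x. \<Phi> (v x)))
        - (real DIM('a) - 2) * integral \<Omega> (\<lambda>x. G x \<bullet> K x)"
proof -
  have cont: "continuous_on (closure \<Omega>) u" "continuous_on (closure \<Omega>) G" "continuous_on (closure \<Omega>) v"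
    "continuous_on (closure \<Omega>) K" "continuous_on (closure \<Omega>) (\<lambda>x. f (u x))"
    "continuous_on (closure \<Omega>) (\<lambda>x. g (v x))" "continuous_on (closure \<Omega>) (\<lambda>x. hessian_apply L x (G x))"
    "continuous_on (closure \<Omega>) (hessian_trace L)" "continuous_on (closure \<Omega>) (hessian_trace H)"
    "continuous_on (closure \<Omega>) (\<lambda>x. hessian_apply L x x)"
    using C2_D[OF u(1)] C2_D[OF v(1)] continuous_on_hessian_apply[OF v(1)]
      continuous_on_compose2[OF F(3)] continuous_on_compose2[OF \<Phi>(3)] by auto
  let ?Y = "\<lambda>x. (x \<bullet> G x) * hessian_trace L x + (1 - real DIM('a)) * (G x \<bullet> K x) - hessian_apply L x (G x) \<bullet> x"
  let ?N = "real DIM('a)"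
  have "flux G H (\<lambda>x. - (x \<bullet> K x)) (\<lambda>x. - (hessian_apply L x x + K x))
      = flux G H (\<lambda>x. - (x \<bullet> K x)) (\<lambda>x. - (hessian_apply L x x + K x)) + integral \<Omega> ?Y"
    using tangential_identity[OF u v(1)] by simp
  also have "\<dots> = integral \<Omega> (\<lambda>x. (- hessian_trace H x * - (x \<bullet> K x) - G x \<bullet> - (hessian_apply L x x + K x)) + ?Y x)"
    unfolding flux_def
    using flux_integrable[OF u(1) C1_minus[OF C1_position_dot_gradient[OF v(1)]]] cont
    by (intro Henstock_Kurzweil_Integration.integral_add[symmetric] integrable_closure continuous_intros) auto
  also have "\<dots> = integral \<Omega> (\<lambda>x. (2 - ?N) * (G x \<bullet> K x) + (- (g (v x) * (x \<bullet> K x)) - f (u x) * (x \<bullet> G x)))"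
  proof (rule Henstock_Kurzweil_Integration.integral_cong)
    fix x assume x: "x \<in> \<Omega>"
    have t: "hessian_trace L x = - f (u x)" "hessian_trace H x = - g (v x)" using eqs[OF x] by auto
    have "hessian_apply L x (G x) \<bullet> x = G x \<bullet> hessian_apply L x x"
      using hessian_apply_symmetric[OF open_dom x v(1)] by (simp add: inner_commute)
    then show "(- hessian_trace H x * - (x \<bullet> K x) - G x \<bullet> - (hessian_apply L x x + K x)) + ?Y x
      = (2 - ?N) * (G x \<bullet> K x) + (- (g (v x) * (x \<bullet> K x)) - f (u x) * (x \<bullet> G x))"
      unfolding t by (simp add: algebra_simps inner_add_right)
  qed
  also have "\<dots> = integral \<Omega> (\<lambda>x. (2 - ?N) * (G x \<bullet> K x))
      + integral \<Omega> (\<lambda>x. - (g (v x) * (x \<bullet> K x)) - f (u x) * (x \<bullet> G x))"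
    using cont by (intro Henstock_Kurzweil_Integration.integral_add integrable_closure continuous_intros)
  also have "integral \<Omega> (\<lambda>x. - (g (v x) * (x \<bullet> K x)) - f (u x) * (x \<bullet> G x))
      = integral \<Omega> (\<lambda>x. - (g (v x) * (x \<bullet> K x))) - integral \<Omega> (\<lambda>x. f (u x) * (x \<bullet> G x))"
    using cont by (intro Henstock_Kurzweil_Integration.integral_diff integrable_closure continuous_intros)
  also have "integral \<Omega> (\<lambda>x. (2 - ?N) * (G x \<bullet> K x)) = (2 - ?N) * integral \<Omega> (\<lambda>x. G x \<bullet> K x)"
    by (rule integral_mult_right)
  also have "integral \<Omega> (\<lambda>x. - (g (v x) * (x \<bullet> K x))) = - integral \<Omega> (\<lambda>x. g (v x) * (x \<bullet> K x))"
    by (rule integral_neg)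
  finally show ?thesis
    using integral_potential[OF C2_D(1)[OF u(1)] u(3) F] integral_potential[OF C2_D(1)[OF v(1)] v(2) \<Phi>]
    unfolding left_diff_distrib distrib_left by linarith
qed

end

section \<open>Propagation of zeros of superharmonic functions\<close>

lemma derivative_positive_part_power:
  assumes "1 \<le> k"
  shows "((\<lambda>t::real. (max t 0) ^ Suc k) has_real_derivative real (Suc k) * (max t 0) ^ k) (at t)"
proof -
  consider "t < 0" | "t > 0" | "t = 0" by linarith
  then show ?thesis
  proof cases
    case 1
    have "((\<lambda>t. 0) has_real_derivative real (Suc k) * (max t 0) ^ k) (at t)"
      using 1 assms by (auto intro!: derivative_eq_intros)
    then show ?thesis
      by (rule DERIV_cong_ev[OF refl _ refl, THEN iffD1, rotated])
         (use 1 eventually_nhds_in_open[of "{..<0}" t] in \<open>auto elim!: eventually_mono\<close>)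
  next
    case 2
    have "((\<lambda>t. t ^ Suc k) has_real_derivative real (Suc k) * (max t 0) ^ k) (at t)"
      using 2 by (intro DERIV_power_Suc[OF DERIV_ident, THEN DERIV_cong]) (simp add: max_def)
    then show ?thesis
      by (rule DERIV_cong_ev[OF refl _ refl, THEN iffD1, rotated])
         (use 2 eventually_nhds_in_open[of "{0<..}" t] in \<open>auto elim!: eventually_mono simp: max_def\<close>)
  next
    case 3
    have "((\<lambda>h::real. (max h 0) ^ Suc k / h) \<longlongrightarrow> 0) (at 0)"
    proof (rule Lim_null_comparison)
      show "((\<lambda>h::real. \<bar>h\<bar> ^ k) \<longlongrightarrow> 0) (at 0)"
        using assms by (auto intro!: tendsto_eq_intros)
      show "\<forall>\<^sub>F h::real in at 0. norm ((max h 0) ^ Suc k / h) \<le> \<bar>h\<bar> ^ k"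
        by (intro always_eventually) (auto simp: max_def abs_mult)
    qed
    moreover have "(0::real) ^ k = 0" using assms by (simp add: power_0_left)
    ultimately show ?thesis using 3 by (simp add: has_field_derivative_iff del: power_eq_0_iff)
  qed
qed

text \<open>The function \<open>(R\<^sup>2 - |x - z|\<^sup>2)\<^sub>+\<close> raised to a power. For a large exponent its Laplacian is positive
in the ball of radius \<open>R\<close> except near the centre.\<close>

definition bump :: "nat \<Rightarrow> 'a::euclidean_space \<Rightarrow> real \<Rightarrow> 'a \<Rightarrow> real" where
  "bump k z R x = (max (R\<^sup>2 - (norm (x - z))\<^sup>2) 0) ^ (k + 2)"

definition bump_gradient :: "nat \<Rightarrow> 'a::euclidean_space \<Rightarrow> real \<Rightarrow> 'a \<Rightarrow> 'a" where
  "bump_gradient k z R x =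
     (real (k + 2) * (max (R\<^sup>2 - (norm (x - z))\<^sup>2) 0) ^ (k + 1)) *\<^sub>R (- 2 *\<^sub>R (x - z))"

definition bump_hessian :: "nat \<Rightarrow> 'a::euclidean_space \<Rightarrow> real \<Rightarrow> 'a \<Rightarrow> 'a \<Rightarrow> 'a" where
  "bump_hessian k z R b x =
     (real (k + 2) * (max (R\<^sup>2 - (norm (x - z))\<^sup>2) 0) ^ (k + 1)) *\<^sub>R (- 2 *\<^sub>R b)
     + (- 2 * ((x - z) \<bullet> b)) *\<^sub>R ((real (k + 2) * (real (k + 1) * (max (R\<^sup>2 - (norm (x - z))\<^sup>2) 0) ^ k)) *\<^sub>R (- 2 *\<^sub>R (x - z)))"

lemma bump_nonneg: "0 \<le> bump k z R x"
  by (simp add: bump_def)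

lemma bump_outside: "0 < R \<Longrightarrow> x \<notin> ball z R \<Longrightarrow> bump k z R x = 0"
  by (simp add: bump_def dist_norm norm_minus_commute max_def)

lemma bump_C2:
  assumes "1 \<le> k"
  shows "C2_with_derivatives S (bump k z R) (bump_gradient k z R) (bump_hessian k z R)"
proof -
  have \<rho>: "C1_with_gradient S (\<lambda>x. R\<^sup>2 - (norm (x - z))\<^sup>2) (\<lambda>x. - 2 *\<^sub>R (x - z))"
    unfolding C1_with_gradient_def gderiv_def power2_norm_eq_inner
    by (auto intro!: continuous_intros derivative_eq_intros simp: inner_diff_right inner_diff_left inner_commute algebra_simps)
  have 1: "C1_with_gradient S (bump k z R) (bump_gradient k z R)"
  proof -
    have "C1_with_gradient S (\<lambda>x. (max (R\<^sup>2 - (norm (x - z))\<^sup>2) 0) ^ Suc (Suc k))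
        (\<lambda>x. (real (Suc (Suc k)) * (max (R\<^sup>2 - (norm (x - z))\<^sup>2) 0) ^ Suc k) *\<^sub>R (- 2 *\<^sub>R (x - z)))"
      by (rule C1_compose[OF \<rho>, of UNIV])
        (use derivative_positive_part_power[of "Suc k"] in \<open>auto intro!: continuous_intros simp del: power_Suc\<close>)
    then show ?thesis by (simp add: bump_def[abs_def] bump_gradient_def[abs_def])
  qed
  have 2: "C1_with_gradient S (\<lambda>x. bump_gradient k z R x \<bullet> b) (bump_hessian k z R b)" for b
  proof -
    have d: "((\<lambda>t. real (k + 2) * (max t 0) ^ Suc k) has_real_derivative
        real (k + 2) * (real (k + 1) * (max t 0) ^ k)) (at t)" for t
      using DERIV_cmult[OF derivative_positive_part_power[OF assms], of "real (k + 2)"] by simp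
    have "C1_with_gradient S (\<lambda>x. real (k + 2) * (max (R\<^sup>2 - (norm (x - z))\<^sup>2) 0) ^ Suc k)
        (\<lambda>x. (real (k + 2) * (real (k + 1) * (max (R\<^sup>2 - (norm (x - z))\<^sup>2) 0) ^ k)) *\<^sub>R (- 2 *\<^sub>R (x - z)))"
      by (rule C1_compose[OF \<rho>, of UNIV], simp, rule d, intro continuous_intros)
    moreover have "C1_with_gradient S (\<lambda>x. - 2 * ((x - z) \<bullet> b)) (\<lambda>x. - 2 *\<^sub>R b)"
      unfolding C1_with_gradient_def gderiv_def
      by (auto intro!: continuous_intros derivative_eq_intros)
    ultimately show ?thesis
      using C1_mult by (fastforce simp: bump_gradient_def[abs_def] bump_hessian_def[abs_def] algebra_simps)
  qed
  show ?thesis unfolding C2_with_derivatives_def using 1 2 by blast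
qed

lemma bump_laplacian:
  fixes z :: "'a::euclidean_space"
  shows "hessian_trace (bump_hessian k z R) x =
    2 * real (k + 2) * (max (R\<^sup>2 - (norm (x - z))\<^sup>2) 0) ^ k *
     (2 * real (k + 1) * (norm (x - z))\<^sup>2 - real DIM('a) * max (R\<^sup>2 - (norm (x - z))\<^sup>2) 0)"
proof -
  define r where "r = max (R\<^sup>2 - (norm (x - z))\<^sup>2) 0"
  have "hessian_trace (bump_hessian k z R) x =
     (\<Sum>b\<in>Basis. - 2 * (real (k + 2) * r ^ (k + 1)) * (b \<bullet> b)
        + 4 * (real (k + 2) * (real (k + 1) * r ^ k)) * (((x - z) \<bullet> b) * ((x - z) \<bullet> b)))"
    unfolding hessian_trace_def bump_hessian_def r_def[symmetric]
    by (intro sum.cong refl) (simp only: inner_add_left inner_scaleR_left, simp add: algebra_simps)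
  also have "\<dots> = - 2 * (real (k + 2) * r ^ (k + 1)) * real DIM('a)
        + 4 * (real (k + 2) * (real (k + 1) * r ^ k)) * ((x - z) \<bullet> (x - z))"
    unfolding sum.distrib sum_distrib_left[symmetric] euclidean_inner[of "x - z" "x - z"] by simp
  finally show ?thesis
    unfolding r_def[symmetric] dot_square_norm by (simp add: algebra_simps)
qed

context null_frontier_domain
begin

lemma zero_of_integral_nonpos:
  fixes k :: "'a \<Rightarrow> real"
  assumes k: "continuous_on (closure \<Omega>) k" "\<And>x. x \<in> \<Omega> \<Longrightarrow> 0 \<le> k x" and int: "integral \<Omega> k \<le> 0"
    and x: "x \<in> \<Omega>"
  shows "k x = 0"
proof -
  obtain a b where ab: "x \<in> box a b" "cbox a b \<subseteq> \<Omega>"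
    using open_contains_cbox[THEN iffD1, OF open_dom] x by metis
  have c: "continuous_on (cbox a b) k"
    using k(1) ab(2) closure_subset continuous_on_subset by (metis subset_trans)
  have "integral (cbox a b) k \<le> integral \<Omega> k"
    using ab k by (intro integral_subset_le integrable_continuous c integrable_closure) auto
  moreover have "0 \<le> integral (cbox a b) k"
    using ab k by (intro integral_nonneg integrable_continuous c) auto
  ultimately have "integral (cbox a b) k = 0" using int by linarith
  then have "(k has_integral 0) (cbox a b)"
    using integrable_integral[OF integrable_continuous[OF c]] by simp
  then show ?thesis
    using has_integral_0_cbox_imp_0[OF c] ab k(2) box_subset_cbox by (metis empty_iff subset_iff)
qed

text \<open>A weak form of the strong maximum principle. The vanishing flux says that \<open>u\<close> is weakly
superharmonic when tested with the bump, so integrating by parts once more gives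
\<open>\<integral> u \<Delta>\<phi> \<le> 0\<close>. With the exponent large enough in terms of \<open>s\<close>, \<open>\<Delta>\<phi>\<close> is positive in the ball
of radius \<open>R\<close> outside the ball of radius \<open>s\<close>, and inside the latter \<open>u\<close> is 0; so \<open>u \<Delta>\<phi>\<close> is
nonnegative with integral at most 0, and \<open>u\<close> must vanish. The inner ball may lie outside the domain.\<close>

lemma zero_propagates_along_bump:
  assumes u: "C2_with_derivatives \<Omega> u G H" "\<And>x. x \<in> closure \<Omega> \<Longrightarrow> 0 \<le> u x"
      "\<And>x. x \<in> frontier \<Omega> \<Longrightarrow> u x = 0" "\<And>x. x \<in> \<Omega> \<Longrightarrow> hessian_trace H x \<le> 0"
    and s: "0 < s" "\<And>x. x \<in> \<Omega> \<Longrightarrow> x \<in> ball z s \<Longrightarrow> u x = 0"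
    and R: "0 < R" and fl: "\<And>k. 1 \<le> k \<Longrightarrow> flux G H (bump k z R) (bump_gradient k z R) = 0"
    and x: "x \<in> \<Omega>" "x \<in> ball z R"
  shows "u x = 0"
proof -
  \<comment> \<open>Makes the positive part of the Laplacian of the bump win for \<open>|x - z| \<ge> s\<close>.\<close>
  obtain n where n: "real n * s\<^sup>2 > real DIM('a) * R\<^sup>2"
    using reals_Archimedean3[of "s\<^sup>2"] s(1) by auto
  define k where "k = n + 1"
  let ?\<phi> = "bump k z R" and ?P = "bump_gradient k z R" and ?Q = "bump_hessian k z R"
  let ?r = "\<lambda>x. max (R\<^sup>2 - (norm (x - z))\<^sup>2) 0"
  have \<phi>: "C2_with_derivatives \<Omega> ?\<phi> ?P ?Q" by (rule bump_C2) (simp add: k_def)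
  have cont: "continuous_on (closure \<Omega>) (\<lambda>x. u x * hessian_trace ?Q x)"
    using C2_D[OF u(1)] C2_D[OF \<phi>] by (intro continuous_intros) auto
  have large: "2 * real (k + 1) * (norm (y - z))\<^sup>2 - real DIM('a) * ?r y > 0" if "y \<notin> ball z s" for y
  proof -
    have "s\<^sup>2 \<le> (norm (y - z))\<^sup>2"
      using that s(1) by (intro power_mono) (auto simp: dist_norm norm_minus_commute)
    then have "real n * s\<^sup>2 \<le> 2 * real (k + 1) * (norm (y - z))\<^sup>2"
      by (intro mult_mono) (auto simp: k_def)
    moreover have "real DIM('a) * ?r y \<le> real DIM('a) * R\<^sup>2"
      by (intro mult_left_mono) auto
    ultimately show ?thesis using n by linarith
  qed
  have nonneg: "0 \<le> u y * hessian_trace ?Q y" if "y \<in> \<Omega>" for y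
  proof (cases "y \<in> ball z s")
    case True
    then show ?thesis using s(2)[OF that] by simp
  next
    case False
    then show ?thesis
      unfolding bump_laplacian using u(2)[OF in_closure[OF that]] large[OF False]
      by (intro mult_nonneg_nonneg) auto
  qed
  have int: "integral \<Omega> (\<lambda>y. u y * hessian_trace ?Q y) \<le> 0"
  proof -
    have "integral \<Omega> (\<lambda>y. - hessian_trace ?Q y * u y - ?P y \<bullet> G y) = 0"
      using flux_zero[OF \<phi> C2_D(1)[OF u(1)]] u(3) unfolding flux_def by blast
    moreover have "integral \<Omega> (\<lambda>y. - hessian_trace ?Q y * u y - ?P y \<bullet> G y)
      = integral \<Omega> (\<lambda>y. - (u y * hessian_trace ?Q y)) - integral \<Omega> (\<lambda>y. G y \<bullet> ?P y)"
      using Henstock_Kurzweil_Integration.integral_diff[of "\<lambda>y. - (u y * hessian_trace ?Q y)" \<Omega> "\<lambda>y. G y \<bullet> ?P y"]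
        cont C2_D[OF u(1)] C2_D[OF \<phi>]
      by (simp add: integrable_closure continuous_intros inner_commute mult.commute)
    moreover have "integral \<Omega> (\<lambda>y. - hessian_trace H y * ?\<phi> y - G y \<bullet> ?P y) = 0"
      using fl[of k] unfolding flux_def by (simp add: k_def)
    moreover have "integral \<Omega> (\<lambda>y. - hessian_trace H y * ?\<phi> y - G y \<bullet> ?P y)
      = integral \<Omega> (\<lambda>y. - hessian_trace H y * ?\<phi> y) - integral \<Omega> (\<lambda>y. G y \<bullet> ?P y)"
      using C2_D[OF u(1)] C2_D[OF \<phi>]
      by (intro Henstock_Kurzweil_Integration.integral_diff integrable_closure continuous_intros)
    moreover have "0 \<le> integral \<Omega> (\<lambda>y. - hessian_trace H y * ?\<phi> y)"
    proof (rule integral_nonneg)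
      show "(\<lambda>y. - hessian_trace H y * ?\<phi> y) integrable_on \<Omega>"
        using C2_D[OF u(1)] C2_D[OF \<phi>] by (intro integrable_closure continuous_intros)
      show "0 \<le> - hessian_trace H y * ?\<phi> y" if "y \<in> \<Omega>" for y
        using u(4)[OF that] bump_nonneg by (intro mult_nonneg_nonneg) auto
    qed
    ultimately show ?thesis by simp
  qed
  have zero: "u x * hessian_trace ?Q x = 0"
    by (rule zero_of_integral_nonpos[OF cont nonneg int x(1)])
  show ?thesis
  proof (cases "x \<in> ball z s")
    case True
    then show ?thesis using s(2) x by blast
  next
    case False
    have "norm (x - z) < R" using x(2) by (simp add: dist_norm norm_minus_commute)
    then have "?r x > 0" by (simp add: power_strict_mono)
    then have "hessian_trace ?Q x > 0"
      unfolding bump_laplacian using large[OF False] by (intro mult_pos_pos zero_less_power) auto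
    then show ?thesis using zero by simp
  qed
qed

text \<open>The interior of the zero set is open and, by propagation from balls inside it, relatively closed.
Bumps supported in the domain vanish on the frontier, so their flux is 0.\<close>

lemma unique_continuation:
  assumes u: "C2_with_derivatives \<Omega> u G H" "\<And>x. x \<in> closure \<Omega> \<Longrightarrow> 0 \<le> u x"
      "\<And>x. x \<in> frontier \<Omega> \<Longrightarrow> u x = 0" "\<And>x. x \<in> \<Omega> \<Longrightarrow> hessian_trace H x \<le> 0"
    and conn: "connected \<Omega>" and V: "open V" "V \<noteq> {}" "V \<subseteq> \<Omega>" "\<And>x. x \<in> V \<Longrightarrow> u x = 0"
    and x: "x \<in> \<Omega>"
  shows "u x = 0"
proof -
  define Z where "Z = interior {y \<in> \<Omega>. u y = 0}"
  have Z0: "y \<in> \<Omega> \<and> u y = 0" if "y \<in> Z" for y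
    using that interior_subset unfolding Z_def by blast
  have "V \<subseteq> Z" unfolding Z_def using V by (intro interior_maximal) auto
  have closed: "y \<in> Z" if y: "y \<in> \<Omega>" "y \<in> closure Z" for y
  proof -
    obtain d where d: "d > 0" "ball y d \<subseteq> \<Omega>" using open_dom y(1) open_contains_ball by blast
    obtain z where z: "z \<in> Z" "dist z y < d / 3"
      using y(2) d(1) unfolding closure_approachable by (metis divide_pos_pos zero_less_numeral)
    obtain s where s: "s > 0" "ball z s \<subseteq> Z"
      using z(1) open_contains_ball[of Z] unfolding Z_def by auto
    have sub: "ball z (d / 2) \<subseteq> \<Omega>"
    proof -
      have "ball z (d / 2) \<subseteq> ball y d"
        using z(2) d(1) by (intro ball_subset_ball_iff[THEN iffD2] disjI1) (simp add: dist_commute)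
      then show ?thesis using d(2) by blast
    qed
    have zero: "u p = 0" if p: "p \<in> ball z (d / 2)" for p
    proof (rule zero_propagates_along_bump[OF u s(1), of z "d / 2"])
      show "flux G H (bump k z (d / 2)) (bump_gradient k z (d / 2)) = 0" if "1 \<le> k" for k
      proof (rule flux_zero[OF u(1) C2_D(1)[OF bump_C2[OF that]]], rule disjI1)
        show "bump k z (d / 2) w = 0" if "w \<in> frontier \<Omega>" for w
          using that sub d(1) open_dom by (intro bump_outside) (auto simp: frontier_def interior_open)
      qed
    qed (use s Z0 d p sub in auto)
    have "ball z (d / 2) \<subseteq> Z"
      unfolding Z_def using zero sub by (intro interior_maximal) auto
    then show ?thesis using z(2) d(1) by (auto simp: subset_iff)
  qed
  have "Z \<inter> \<Omega> = {} \<or> (- closure Z) \<inter> \<Omega> = {}"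
  proof (rule connectedD[OF conn])
    show "open Z" unfolding Z_def by simp
    show "Z \<inter> - closure Z \<inter> \<Omega> = {}" using closure_subset by blast
    show "\<Omega> \<subseteq> Z \<union> - closure Z" using closed by blast
  qed (simp add: open_Compl)
  moreover have "Z \<inter> \<Omega> \<noteq> {}" using \<open>V \<subseteq> Z\<close> V by blast
  ultimately have "x \<in> closure Z" using x by blast
  then show ?thesis using closed[OF x] Z0 by blast
qed

text \<open>Zero flux near \<open>a\<close> means that the extension of \<open>u\<close> by 0 is superharmonic across the
frontier. A ball around an exterior point \<open>z\<close> close to \<open>a\<close> serves as the initial ball
of zeros, and a larger ball around \<open>z\<close> reaches into the domain.\<close>

lemma zero_if_flux_vanishes_near_frontier_point:
  assumes u: "C2_with_derivatives \<Omega> u G H" "\<And>x. x \<in> closure \<Omega> \<Longrightarrow> 0 \<le> u x"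
      "\<And>x. x \<in> frontier \<Omega> \<Longrightarrow> u x = 0" "\<And>x. x \<in> \<Omega> \<Longrightarrow> hessian_trace H x \<le> 0"
    and conn: "connected \<Omega>" and a: "a \<in> frontier \<Omega>" "C1_graph_at \<Omega> a e \<gamma>" and r: "0 < r"
    and fl: "\<And>\<phi> P. C1_with_gradient \<Omega> \<phi> P \<Longrightarrow> (\<And>x. 0 \<le> \<phi> x) \<Longrightarrow> (\<And>x. x \<notin> ball a r \<Longrightarrow> \<phi> x = 0)
          \<Longrightarrow> flux G H \<phi> P = 0"
    and x: "x \<in> \<Omega>"
  shows "u x = 0"
proof -
  obtain \<rho> where e: "norm e = 1" and \<gamma>: "Ck_closure 1 UNIV \<gamma>" "\<And>y t. \<gamma> (y + t *\<^sub>R e) = \<gamma> y"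
    and \<rho>: "\<rho> > 0" "\<Omega> \<inter> ball a \<rho> = {y \<in> ball a \<rho>. \<gamma> y < y \<bullet> e}"
    using a(2) unfolding C1_graph_at_def by blast
  obtain \<Gamma> where \<Gamma>: "C1_with_gradient UNIV \<gamma> \<Gamma>" using Ck_closure_1_C1[OF \<gamma>(1)] by blast
  have \<gamma>c: "continuous_on UNIV \<gamma>" using C1_with_gradientD(1)[OF \<Gamma>] by simp
  have \<gamma>a: "\<gamma> a = a \<bullet> e" using graph_frontier[OF \<gamma>c \<rho>(2) _ a(1)] \<rho>(1) by simp
  \<comment> \<open>A point strictly below the graph lies outside the closure of the domain.\<close>
  define t where "t = min \<rho> r / 4"
  define z where "z = a - t *\<^sub>R e"
  have t: "0 < t" "t < \<rho>" "3 * t < r" using \<rho>(1) r by (auto simp: t_def)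
  have dz: "dist z a = t" using t e by (simp add: z_def dist_norm)
  have zb: "z \<in> ball a \<rho>" using dz t by (simp add: dist_commute)
  have \<gamma>z: "\<gamma> z = \<gamma> a" using \<gamma>(2)[of a "- t"] by (simp add: z_def)
  have ze: "z \<bullet> e = a \<bullet> e - t"
    using e by (simp add: z_def inner_diff_left dot_square_norm)
  have "\<not> \<gamma> z < z \<bullet> e" "\<gamma> z \<noteq> z \<bullet> e" using \<gamma>z ze \<gamma>a t by auto
  then have "z \<notin> \<Omega>" "z \<notin> frontier \<Omega>"
    using \<rho>(2) zb graph_frontier[OF \<gamma>c \<rho>(2) zb] by blast+
  then have "z \<in> - closure \<Omega>" using open_dom by (simp add: frontier_def interior_open)
  then obtain s where s: "s > 0" "ball z s \<subseteq> - closure \<Omega>"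
    using open_contains_ball[of "- closure \<Omega>"] by auto
  have sub: "ball z (2 * t) \<subseteq> ball a r"
    using dz t by (intro ball_subset_ball_iff[THEN iffD2]) simp
  have zero: "u y = 0" if y: "y \<in> \<Omega> \<inter> ball z (2 * t)" for y
  proof (rule zero_propagates_along_bump[OF u s(1), of z "2 * t"])
    show "flux G H (bump k z (2 * t)) (bump_gradient k z (2 * t)) = 0" if "1 \<le> k" for k
    proof (rule fl[OF C2_D(1)[OF bump_C2[OF that]] bump_nonneg])
      show "bump k z (2 * t) y = 0" if "y \<notin> ball a r" for y
        using that sub t by (intro bump_outside) auto
    qed
  qed (use s y t in auto)
  have "a \<in> closure \<Omega> \<inter> ball z (2 * t)" using a(1) dz t by (auto simp: frontier_def)
  then have "\<Omega> \<inter> ball z (2 * t) \<noteq> {}"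
    using open_Int_closure_eq_empty[OF open_ball, of z "2 * t" \<Omega>] by blast
  then show ?thesis
    using zero open_dom by (intro unique_continuation[OF u conn _ _ _ _ x, of "\<Omega> \<inter> ball z (2 * t)"]) auto
qed

end

section \<open>Boundary signs for star-shaped domains\<close>

text \<open>As \<open>\<gamma>\<close> is constant along \<open>e\<close>, \<open>D\<close> is orthogonal to \<open>e\<close>.\<close>

lemma graph_normal_nonzero:
  assumes "C1_graph_at S x e \<gamma>" "GDERIV \<gamma> x :> D"
  shows "D \<noteq> e"
proof
  assume "D = e"
  have e: "norm e = 1" and inv: "\<And>t. \<gamma> (x + t *\<^sub>R e) = \<gamma> x"
    using assms(1) unfolding C1_graph_at_def by auto
  have "((\<lambda>t. \<gamma> (x + t *\<^sub>R e)) has_derivative (\<lambda>t. (t *\<^sub>R e) \<bullet> D)) (at 0)"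
    by (rule has_derivative_compose[where f = "\<lambda>t. x + t *\<^sub>R e" and g = \<gamma>])
       (use assms(2) in \<open>auto intro!: derivative_eq_intros simp: gderiv_def\<close>)
  then have "((\<lambda>t. \<gamma> x) has_derivative (\<lambda>t. (t *\<^sub>R e) \<bullet> D)) (at (0::real))" by (simp add: inv)
  then have "(\<lambda>t. (t *\<^sub>R e) \<bullet> D) = (\<lambda>t::real. 0)"
    using has_derivative_unique[OF _ has_derivative_const] by blast
  then have "(1 *\<^sub>R e) \<bullet> D = 0" by meson
  then show False using \<open>D = e\<close> e by (simp add: dot_square_norm)
qed

text \<open>The direction \<open>- x\<close> points weakly into \<open>S\<close>; it is a limit of the strictly inward directions
\<open>- x - s (D - e)\<close>.\<close>

lemma frontier_position_derivative_nonpos: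
  assumes graph: "C1_graph_at S x e \<gamma>" "GDERIV \<gamma> x :> D" and x: "x \<in> frontier S"
    and star: "0 \<le> x \<bullet> sgn (D - e)"
    and w: "C1_with_gradient S w G" "\<And>y. y \<in> S \<Longrightarrow> 0 \<le> w y" "w x = 0"
  shows "x \<bullet> G x \<le> 0"
proof (rule ccontr)
  assume pos: "\<not> x \<bullet> G x \<le> 0"
  let ?n = "D - e"
  have n: "?n \<noteq> 0" using graph_normal_nonzero[OF graph] by simp
  have xn: "0 \<le> x \<bullet> ?n"
    using star n by (simp add: sgn_div_norm zero_le_mult_iff)
  have ineq: "0 \<le> - (x \<bullet> G x) - s * (G x \<bullet> ?n)" if "s > 0" for s
  proof -
    have "(- x - s *\<^sub>R ?n) \<bullet> ?n < 0"
    proof -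
      have "0 < s * (?n \<bullet> ?n)" using n that by (intro mult_pos_pos) auto
      moreover have "(- x - s *\<^sub>R ?n) \<bullet> ?n = - (x \<bullet> ?n) - s * (?n \<bullet> ?n)"
        by (simp only: inner_diff_left[of "- x"] inner_minus_left inner_scaleR_left)
      ultimately show ?thesis using xn by linarith
    qed
    from inward_derivative_nonneg[OF graph x w this]
    show ?thesis
      by (simp only: inner_diff_right[of _ "- x"] inner_minus_right inner_scaleR_right) (simp add: inner_commute)
  qed
  define s where "s = (x \<bullet> G x) / (2 * (\<bar>G x \<bullet> ?n\<bar> + 1))"
  have s: "s > 0" using pos unfolding s_def by (intro divide_pos_pos) auto
  have "\<bar>s * (G x \<bullet> ?n)\<bar> \<le> s * (\<bar>G x \<bullet> ?n\<bar> + 1)" using s by (simp add: abs_mult)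
  also have "\<dots> = (x \<bullet> G x) / 2" by (simp add: s_def field_simps)
  finally show False using ineq[OF s] pos by linarith
qed

text \<open>Where \<open>x\<close> is transversal to the frontier, \<open>- x\<close> is interior to the cone of inward directions. The
derivative of \<open>w\<close> is nonnegative on this cone and 0 in its interior direction \<open>- x\<close>, so it is 0.
Transversality persists near \<open>a\<close> because the gradient of the single graph function \<open>\<gamma>\<close> is
continuous.\<close>

lemma gradient_zero_on_transversal_frontier:
  assumes graph: "C1_graph_at S a e \<gamma>" "GDERIV \<gamma> a :> D" and star: "0 < a \<bullet> sgn (D - e)"
    and w: "C1_with_gradient S w G" "\<And>y. y \<in> S \<Longrightarrow> 0 \<le> w y" "\<And>y. y \<in> frontier S \<Longrightarrow> w y = 0"
    and zero: "\<And>y. y \<in> frontier S \<Longrightarrow> y \<bullet> G y = 0"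
  obtains r where "r > 0" "\<And>y. y \<in> frontier S \<Longrightarrow> y \<in> ball a r \<Longrightarrow> G y = 0"
proof -
  obtain \<rho> where e: "norm e = 1" and \<gamma>: "Ck_closure 1 UNIV \<gamma>" "\<And>y t. \<gamma> (y + t *\<^sub>R e) = \<gamma> y"
    and \<rho>: "\<rho> > 0" "S \<inter> ball a \<rho> = {y \<in> ball a \<rho>. \<gamma> y < y \<bullet> e}"
    using graph(1) unfolding C1_graph_at_def by blast
  obtain \<Gamma> where \<Gamma>: "C1_with_gradient UNIV \<gamma> \<Gamma>" using Ck_closure_1_C1[OF \<gamma>(1)] by blast
  have "\<Gamma> a = D" by (rule C1_gradient_unique[OF \<Gamma> UNIV_I graph(2)])
  have "D - e \<noteq> 0" using graph_normal_nonzero[OF graph] by simp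
  then have "a \<bullet> (\<Gamma> a - e) > 0"
    using star \<open>\<Gamma> a = D\<close> by (simp add: sgn_div_norm zero_less_mult_iff)
  moreover have "open {y. 0 < y \<bullet> (\<Gamma> y - e)}"
    using C1_with_gradientD(2)[OF \<Gamma>] by (intro open_Collect_less continuous_intros) auto
  ultimately obtain r1 where r1: "r1 > 0" "ball a r1 \<subseteq> {y. 0 < y \<bullet> (\<Gamma> y - e)}"
    unfolding open_contains_ball by blast
  have "G y = 0" if y: "y \<in> frontier S" "y \<in> ball a (min \<rho> r1)" for y
  proof -
    let ?n = "\<Gamma> y - e"
    have "y \<in> ball a r1" using y(2) by simp
    then have yn: "0 < y \<bullet> ?n" using r1(2) by blast
    have graph_y: "C1_graph_at S y e \<gamma>"
    proof -
      have sub: "ball y (\<rho> - dist a y) \<subseteq> ball a \<rho>"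
        using y(2) by (intro ball_subset_ball_iff[THEN iffD2] disjI1) (simp add: dist_commute)
      have "0 < \<rho> - dist a y" using y(2) by simp
      moreover have "S \<inter> ball y (\<rho> - dist a y) = {p \<in> ball y (\<rho> - dist a y). \<gamma> p < p \<bullet> e}"
        using sub \<rho>(2) by blast
      ultimately show ?thesis unfolding C1_graph_at_def using e \<gamma> by blast
    qed
    have dy: "GDERIV \<gamma> y :> \<Gamma> y" using C1_with_gradientD(3)[OF \<Gamma>] by simp
    \<comment> \<open>The direction \<open>- y\<close> is interior to the inward cone, and the derivative along it vanishes.\<close>
    have half: "0 \<le> G y \<bullet> h" for h
    proof -
      define s where "s = (y \<bullet> ?n) / (2 * (\<bar>h \<bullet> ?n\<bar> + 1))"
      have s: "s > 0" using yn unfolding s_def by (intro divide_pos_pos) auto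
      have "s * (h \<bullet> ?n) \<le> s * (\<bar>h \<bullet> ?n\<bar> + 1)" using s by (intro mult_left_mono) auto
      also have "\<dots> = (y \<bullet> ?n) / 2" by (simp add: s_def field_simps)
      also have "\<dots> < y \<bullet> ?n" using yn by simp
      finally have "(- y + s *\<^sub>R h) \<bullet> ?n < 0"
        by (simp only: inner_add_left inner_minus_left inner_scaleR_left)
      from inward_derivative_nonneg[OF graph_y dy y(1) w(1,2) w(3)[OF y(1)] this]
      have "0 \<le> - (y \<bullet> G y) + s * (G y \<bullet> h)" by (simp add: inner_diff_right inner_commute)
      then show ?thesis using zero[OF y(1)] s by (simp add: zero_le_mult_iff)
    qed
    have "0 \<le> G y \<bullet> - G y" by (rule half)
    then have "G y \<bullet> G y = 0" using inner_ge_zero[of "G y"] by (simp only: inner_minus_right)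
    then show "G y = 0" by simp
  qed
  then show ?thesis using that[of "min \<rho> r1"] \<rho>(1) r1(1) by simp
qed

section \<open>The nonlinearity\<close>

text \<open>Extended by 0 to negative arguments, which makes it continuous on the whole line, so that its
antiderivative is differentiable from both sides at 0, a value that \<open>u\<close> might take inside the domain.\<close>

definition log_power :: "real \<Rightarrow> real \<Rightarrow> real \<Rightarrow> real" where
  "log_power p \<alpha> s = (max s 0) powr p / (ln (exp 1 + max s 0)) powr \<alpha>"

lemma ln_exp1_ge_1: "0 \<le> s \<Longrightarrow> 1 \<le> ln (exp 1 + s :: real)"
  by (metis add_increasing2 exp_gt_zero ln_exp ln_le_cancel_iff add_pos_nonneg le_add_same_cancel1)

lemma log_power_nonneg: "0 \<le> log_power p \<alpha> s"
  by (simp add: log_power_def)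

lemma log_power_eq_0: "0 < p \<Longrightarrow> 0 \<le> s \<Longrightarrow> log_power p \<alpha> s = 0 \<Longrightarrow> s = 0"
  using ln_exp1_ge_1[of s] by (auto simp: log_power_def max_def split: if_splits)

lemma continuous_log_power:
  assumes "0 < p"
  shows "continuous_on UNIV (log_power p \<alpha>)"
proof -
  have l: "1 \<le> ln (exp 1 + max s 0 :: real)" for s by (rule ln_exp1_ge_1) simp
  have l0: "ln (exp 1 + max s 0 :: real) \<noteq> 0" for s using l[of s] by linarith
  have e0: "exp 1 + max s 0 \<noteq> (0::real)" for s
    by (metis add_pos_nonneg exp_gt_zero max.cobounded2 less_irrefl)
  have "continuous_on UNIV (\<lambda>s::real. (max s 0) powr p)"
    using assms by (intro continuous_on_powr' continuous_intros) auto
  moreover have "continuous_on UNIV (\<lambda>s::real. (ln (exp 1 + max s 0)) powr \<alpha>)"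
    using l0 e0 by (intro continuous_on_powr continuous_on_ln continuous_intros) auto
  ultimately show ?thesis
    unfolding log_power_def[abs_def] using l0 by (intro continuous_on_divide) auto
qed

text \<open>For \<open>0 \<le> r \<le> s\<close> the logarithmic factor \<open>ln(e + r) powr - \<alpha>\<close> is at most its value at \<open>s\<close>, as
\<open>\<alpha> \<le> 0\<close>. Replacing it by this value \<open>c\<close> and integrating \<open>c r powr p\<close> from 0 to \<open>s\<close> gives the bound.\<close>

lemma log_power_antiderivative:
  assumes p: "0 < p" and \<alpha>: "\<alpha> \<le> 0"
  obtains F where "\<And>s. (F has_real_derivative log_power p \<alpha> s) (at s)" "F 0 = 0"
    "\<And>s. 0 \<le> s \<Longrightarrow> (p + 1) * F s \<le> s * log_power p \<alpha> s"
proof -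
  let ?f = "log_power p \<alpha>"
  note cont = continuous_log_power[OF p, of \<alpha>]
  have neg: "?f s = 0" if "s \<le> 0" for s using that by (simp add: log_power_def)
  \<comment> \<open>Starting at \<open>- 1\<close>, where the integrand is still 0, makes 0 an interior point.\<close>
  define F where "F s = integral {-1..s} ?f" for s :: real
  have F_neg: "F s = 0" if "s \<le> 0" for s
  proof -
    have "F s = integral {-1..s} (\<lambda>_. 0)"
      unfolding F_def using that neg by (intro Henstock_Kurzweil_Integration.integral_cong) auto
    then show ?thesis by simp
  qed
  have der: "(F has_real_derivative ?f s) (at s)" for s
  proof (cases "s < 0")
    case True
    have "((\<lambda>t. 0) has_real_derivative ?f s) (at s)" using neg[of s] True by simp
    then show ?thesis
      by (rule DERIV_cong_ev[OF refl _ refl, THEN iffD1, rotated])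
         (use True F_neg eventually_nhds_in_open[of "{..<0}" s] in \<open>auto elim!: eventually_mono\<close>)
  next
    case False
    have "(F has_real_derivative ?f s) (at s within {-1..s + 1})"
      unfolding F_def[abs_def] using False continuous_on_subset[OF cont]
      by (intro integral_has_real_derivative) auto
    moreover have "s \<in> interior {-1..s + 1}" using False by simp
    ultimately show ?thesis by (metis at_within_interior)
  qed
  have bound: "(p + 1) * F s \<le> s * ?f s" if "0 \<le> s" for s
  proof (cases "s = 0")
    case True
    then show ?thesis using F_neg[of 0] by simp
  next
    case False
    then have s: "s > 0" using that by simp
    define c where "c = 1 / (ln (exp 1 + s)) powr \<alpha>"
    define h where "h = (\<lambda>r. c * r powr (p + 1) / (p + 1) - F r)"
    have "h 0 \<le> h s"
    proof (rule DERIV_nonneg_imp_increasing_open[of 0 s h])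
      show "0 \<le> s" using s by simp
      have "continuous_on {0..s} F"
        using der by (meson DERIV_isCont continuous_at_imp_continuous_on)
      then show "continuous_on {0..s} h"
        unfolding h_def using p by (intro continuous_intros continuous_on_powr') auto
      fix r assume r: "0 < r" "r < s"
      have "((\<lambda>r. r powr (p + 1)) has_real_derivative (p + 1) * r powr p) (at r)"
        using has_real_derivative_powr[OF r(1), of "p + 1"] by simp
      from DERIV_cdivide[OF DERIV_cmult[OF this, of c], of "p + 1"]
      have "((\<lambda>r. c * r powr (p + 1) / (p + 1)) has_real_derivative c * r powr p) (at r)"
        using p by simp
      then have "(h has_real_derivative c * r powr p - ?f r) (at r)"
        unfolding h_def by (intro DERIV_diff der)
      moreover have "?f r \<le> c * r powr p"
      proof -
        have lr: "1 \<le> ln (exp 1 + r)" using ln_exp1_ge_1[of r] r by simp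
        have "ln (exp 1 + r) \<le> ln (exp 1 + s)"
          using r by (intro ln_mono) (auto simp: add_pos_pos)
        then have "ln (exp 1 + s) powr \<alpha> \<le> ln (exp 1 + r) powr \<alpha>"
          using lr \<alpha> by (intro powr_mono2') auto
        moreover have "0 < ln (exp 1 + s) powr \<alpha>"
          using ln_exp1_ge_1[of s] s by (simp add: powr_gt_zero)
        ultimately have "r powr p / ln (exp 1 + r) powr \<alpha> \<le> r powr p / ln (exp 1 + s) powr \<alpha>"
          by (intro divide_left_mono mult_pos_pos) auto
        then show ?thesis using r by (simp add: log_power_def c_def max_def)
      qed
      ultimately show "\<exists>y. (h has_real_derivative y) (at r) \<and> 0 \<le> y" by (intro exI conjI) auto
    qed
    then have "F s \<le> c * s powr (p + 1) / (p + 1)"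
      using p F_neg[of 0] by (simp add: h_def)
    also have "c * s powr (p + 1) = s * ?f s"
      using s by (simp add: c_def log_power_def max_def powr_add)
    finally show ?thesis using p by (simp add: pos_le_divide_eq mult.commute)
  qed
  show ?thesis using that[of F] der F_neg[of 0] bound by simp
qed

section \<open>The Lane-Emden system with logarithmic factors\<close>

context null_frontier_domain
begin

lemma zero_source:
  assumes u: "C2_with_derivatives \<Omega> u G H" "\<And>x. x \<in> \<Omega> \<Longrightarrow> u x = 0" and x: "x \<in> \<Omega>"
  shows "hessian_trace H x = 0"
proof -
  have G: "G y = 0" if "y \<in> \<Omega>" for y
    using u(2) that by (intro gradient_zero_at_minimum[OF C2_D(1)[OF u(1)] open_dom]) auto
  have "H b x = 0" if "b \<in> Basis" for b
    using G x by (intro gradient_zero_at_minimum[OF C2_D(2)[OF u(1) that] open_dom]) auto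
  then show ?thesis by (simp add: hessian_trace_def)
qed

text \<open>Near \<open>a\<close> the function \<open>\<psi>\<close> is bounded below by a positive constant on the frontier, so it
dominates a small multiple \<open>c \<phi>\<close> of any bounded \<open>\<phi>\<close> supported there, and
\<open>0 \<le> c flux \<phi> \<le> flux \<psi> = 0\<close>.\<close>

lemma flux_localizes:
  assumes u: "C2_with_derivatives \<Omega> u G H" "\<And>x. x \<in> closure \<Omega> \<Longrightarrow> 0 \<le> u x"
      "\<And>x. x \<in> frontier \<Omega> \<Longrightarrow> u x = 0" "\<And>x. x \<in> \<Omega> \<Longrightarrow> hessian_trace H x \<le> 0"
    and \<psi>: "C1_with_gradient \<Omega> \<psi> P" "\<And>x. x \<in> frontier \<Omega> \<Longrightarrow> 0 \<le> \<psi> x" "flux G H \<psi> P = 0"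
    and a: "a \<in> frontier \<Omega>" "0 < \<psi> a"
  obtains r where "r > 0" "\<And>\<phi> Q. C1_with_gradient \<Omega> \<phi> Q \<Longrightarrow> (\<And>x. 0 \<le> \<phi> x) \<Longrightarrow>
      (\<And>x. x \<notin> ball a r \<Longrightarrow> \<phi> x = 0) \<Longrightarrow> flux G H \<phi> Q = 0"
proof -
  have cl: "a \<in> closure \<Omega>" using a(1) by (simp add: frontier_def)
  obtain r where r: "r > 0" "\<And>y. y \<in> closure \<Omega> \<Longrightarrow> dist y a < r \<Longrightarrow> dist (\<psi> y) (\<psi> a) < \<psi> a / 2"
    using C1_with_gradientD(1)[OF \<psi>(1)] cl a(2) unfolding continuous_on_iff
    by (metis half_gt_zero)
  have "flux G H \<phi> Q = 0"
    if \<phi>: "C1_with_gradient \<Omega> \<phi> Q" "\<And>x. 0 \<le> \<phi> x" "\<And>x. x \<notin> ball a r \<Longrightarrow> \<phi> x = 0" for \<phi> Q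
  proof -
    obtain M where M: "M > 0" "\<And>x. x \<in> closure \<Omega> \<Longrightarrow> norm (\<phi> x) \<le> M"
      using bounded_closure[OF C1_with_gradientD(1)[OF \<phi>(1)]] by blast
    define c where "c = \<psi> a / (2 * M)"
    have "c > 0" using a(2) M(1) by (simp add: c_def)
    have c\<phi>: "C1_with_gradient \<Omega> (\<lambda>x. - c * \<phi> x) (\<lambda>x. - c *\<^sub>R Q x)"
      using C1_mult[OF C1_const[of \<Omega> "- c"] \<phi>(1)] by simp
    have "0 \<le> flux G H (\<lambda>x. \<psi> x + - c * \<phi> x) (\<lambda>x. P x + - c *\<^sub>R Q x)"
    proof (rule flux_nonneg_frontier[OF u C1_add[OF \<psi>(1) c\<phi>]])
      fix x assume x: "x \<in> frontier \<Omega>"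
      then have xc: "x \<in> closure \<Omega>" by (simp add: frontier_def)
      show "0 \<le> \<psi> x + - c * \<phi> x"
      proof (cases "x \<in> ball a r")
        case True
        have "\<bar>\<psi> x - \<psi> a\<bar> < \<psi> a / 2"
          using r(2)[OF xc] True unfolding mem_ball dist_commute[of a x] dist_real_def by blast
        then have "\<psi> x \<ge> \<psi> a / 2" by linarith
        moreover have "c * \<phi> x \<le> c * M" using M(2)[OF xc] \<open>c > 0\<close> by (intro mult_left_mono) auto
        moreover have "c * M = \<psi> a / 2" using M(1) by (simp add: c_def)
        ultimately show ?thesis by simp
      next
        case False
        then show ?thesis using \<phi>(3) \<psi>(2)[OF x] by simp
      qed
    qed
    also have "\<dots> = - c * flux G H \<phi> Q"
      unfolding flux_add[OF u(1) \<psi>(1) c\<phi>] flux_scale \<psi>(3) by simp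
    finally have "flux G H \<phi> Q \<le> 0" using \<open>c > 0\<close> by (simp add: mult_le_0_iff)
    moreover have "0 \<le> flux G H \<phi> Q" by (rule flux_nonneg[OF u \<phi>(1,2)])
    ultimately show ?thesis by simp
  qed
  then show ?thesis using that r(1) by blast
qed

text \<open>Both energies \<open>\<integral> u f(u)\<close> and \<open>\<integral> v g(v)\<close> equal \<open>\<integral> \<nabla>u \<bullet> \<nabla>v\<close>, so a bound of the potentials by
them turns the right side of the Pohozaev identity into a multiple of \<open>E\<close>.\<close>

lemma pohozaev_inequality:
  assumes u: "C2_with_derivatives \<Omega> u G H" "\<And>x. x \<in> closure \<Omega> \<Longrightarrow> 0 \<le> u x"
      "\<And>x. x \<in> frontier \<Omega> \<Longrightarrow> u x = 0"
    and v: "C2_with_derivatives \<Omega> v K L" "\<And>x. x \<in> closure \<Omega> \<Longrightarrow> 0 \<le> v x"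
      "\<And>x. x \<in> frontier \<Omega> \<Longrightarrow> v x = 0"
    and eqs: "\<And>x. x \<in> \<Omega> \<Longrightarrow> - hessian_trace L x = log_power p \<alpha> (u x)"
      "\<And>x. x \<in> \<Omega> \<Longrightarrow> - hessian_trace H x = log_power q \<beta> (v x)"
    and pq: "0 < p" "0 < q" "\<alpha> \<le> 0" "\<beta> \<le> 0"
  defines "E \<equiv> integral \<Omega> (\<lambda>x. u x * log_power p \<alpha> (u x))"
  shows "flux G H (\<lambda>x. - (x \<bullet> K x)) (\<lambda>x. - (hessian_apply L x x + K x))
      \<le> (real DIM('a) * (1 / (p + 1) + 1 / (q + 1)) - (real DIM('a) - 2)) * E"
proof -
  obtain F where F: "\<And>s. (F has_real_derivative log_power p \<alpha> s) (at s)" "F 0 = 0"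
    "\<And>s. 0 \<le> s \<Longrightarrow> (p + 1) * F s \<le> s * log_power p \<alpha> s"
    using log_power_antiderivative[OF pq(1,3)] by blast
  obtain \<Phi> where \<Phi>: "\<And>s. (\<Phi> has_real_derivative log_power q \<beta> s) (at s)" "\<Phi> 0 = 0"
    "\<And>s. 0 \<le> s \<Longrightarrow> (q + 1) * \<Phi> s \<le> s * log_power q \<beta> s"
    using log_power_antiderivative[OF pq(2,4)] by blast
  have Eu: "E = integral \<Omega> (\<lambda>x. G x \<bullet> K x)"
    unfolding E_def by (rule energy_identity[OF C2_D(1)[OF u(1)] u(3) v(1) eqs(1)])
  have Ev: "E = integral \<Omega> (\<lambda>x. v x * log_power q \<beta> (v x))"
    unfolding Eu using energy_identity[OF C2_D(1)[OF v(1)] v(3) u(1) eqs(2)] by (simp add: inner_commute)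
  have potential: "integral \<Omega> (\<lambda>x. T (w x)) \<le> integral \<Omega> (\<lambda>x. w x * log_power m \<theta> (w x)) / (m + 1)"
    if m: "0 < m" and T: "\<And>s. (T has_real_derivative log_power m \<theta> s) (at s)"
      "\<And>s. 0 \<le> s \<Longrightarrow> (m + 1) * T s \<le> s * log_power m \<theta> s"
      and w: "continuous_on (closure \<Omega>) w" "\<And>x. x \<in> closure \<Omega> \<Longrightarrow> 0 \<le> w x" for m \<theta> T w
  proof -
    have Tc: "continuous_on UNIV T" using T(1) by (meson DERIV_isCont continuous_at_imp_continuous_on)
    have "continuous_on (closure \<Omega>) (\<lambda>x. T (w x))" "continuous_on (closure \<Omega>) (\<lambda>x. log_power m \<theta> (w x))"
      using continuous_on_compose2[OF Tc w(1)] continuous_on_compose2[OF continuous_log_power[OF m] w(1)] by auto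
    then have "integral \<Omega> (\<lambda>x. T (w x)) \<le> integral \<Omega> (\<lambda>x. w x * log_power m \<theta> (w x) / (m + 1))"
    proof (intro integral_le integrable_closure)
      show "T (w x) \<le> w x * log_power m \<theta> (w x) / (m + 1)" if "x \<in> \<Omega>" for x
        using T(2)[OF w(2)[OF in_closure[OF that]]] m
        by (simp add: pos_le_divide_eq mult.commute[of "T (w x)"])
    qed (use w(1) m in \<open>auto intro!: continuous_intros\<close>)
    then show ?thesis by simp
  qed
  have "integral \<Omega> (\<lambda>x. F (u x)) \<le> E / (p + 1)"
    unfolding E_def by (rule potential[OF pq(1) F(1,3) C2_D(3)[OF u(1)] u(2)])
  moreover have "integral \<Omega> (\<lambda>x. \<Phi> (v x)) \<le> E / (q + 1)"
    unfolding Ev by (rule potential[OF pq(2) \<Phi>(1,3) C2_D(3)[OF v(1)] v(2)])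
  ultimately have "real DIM('a) * (integral \<Omega> (\<lambda>x. F (u x)) + integral \<Omega> (\<lambda>x. \<Phi> (v x)))
      \<le> real DIM('a) * (E / (p + 1) + E / (q + 1))"
    by (intro mult_left_mono add_mono) auto
  then show ?thesis
    using pohozaev_identity[OF u v(1,3) eqs F(1,2) continuous_log_power[OF pq(1)] \<Phi>(1,2) continuous_log_power[OF pq(2)]]
    unfolding Eu[symmetric] by (simp add: algebra_simps)
qed

end

theorem theorem4p2:
  fixes \<Omega> :: "(real ^ 'n) set" and \<nu> :: "real ^ 'n \<Rightarrow> real ^ 'n"
    and u v :: "real ^ 'n \<Rightarrow> real" and p q \<alpha> \<beta> :: real
  assumes "CARD('n) \<ge> 3"
    and "bounded_domain \<Omega>" and "C1_boundary \<Omega>" and "exterior_unit_normal \<Omega> \<nu>"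
    and "p > 0" and "q > 0" and "\<alpha> \<le> 0" and "\<beta> \<le> 0"
    and "Ck_closure 2 \<Omega> u" and "Ck_closure 2 \<Omega> v"
    and "\<forall>x\<in>closure \<Omega>. u x \<ge> 0" and "\<forall>x\<in>closure \<Omega>. v x \<ge> 0"
    and "\<forall>x\<in>\<Omega>. - laplacian v x = u x powr p / (ln (exp 1 + u x)) powr \<alpha>"
    and "\<forall>x\<in>\<Omega>. - laplacian u x = v x powr q / (ln (exp 1 + v x)) powr \<beta>"
    and "\<forall>x\<in>frontier \<Omega>. u x = 0 \<and> v x = 0"
  shows "(1 / (p + 1) + 1 / (q + 1) = (real CARD('n) - 2) / real CARD('n) \<and>
            strongly_star_shaped_0 \<Omega> \<nu> \<longrightarrow> (\<forall>x\<in>\<Omega>. u x = 0 \<and> v x = 0)) \<and>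
         (1 / (p + 1) + 1 / (q + 1) < (real CARD('n) - 2) / real CARD('n) \<and>
            star_shaped_0 \<Omega> \<nu> \<longrightarrow> (\<forall>x\<in>\<Omega>. u x = 0 \<and> v x = 0))"
proof -
  have dom: "open \<Omega>" "bounded \<Omega>" "connected \<Omega>" using assms(2) by (auto simp: bounded_domain_def)
  interpret null_frontier_domain \<Omega>
    using dom C1_boundary_negligible_frontier[OF assms(3)] by unfold_locales
  obtain G H where u: "C2_with_derivatives \<Omega> u G H"
    "\<And>x. x \<in> \<Omega> \<Longrightarrow> laplacian u x = hessian_trace H x"
    using Ck_closure_2_C2[OF dom(1) assms(9)] by (metis hessian_trace_def)
  obtain K L where v: "C2_with_derivatives \<Omega> v K L"
    "\<And>x. x \<in> \<Omega> \<Longrightarrow> laplacian v x = hessian_trace L x"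
    using Ck_closure_2_C2[OF dom(1) assms(10)] by (metis hessian_trace_def)
  have u0: "\<And>x. x \<in> closure \<Omega> \<Longrightarrow> 0 \<le> u x" "\<And>x. x \<in> frontier \<Omega> \<Longrightarrow> u x = 0"
    and v0: "\<And>x. x \<in> closure \<Omega> \<Longrightarrow> 0 \<le> v x" "\<And>x. x \<in> frontier \<Omega> \<Longrightarrow> v x = 0"
    using assms(11,12,15) by auto
  have eqs: "\<And>x. x \<in> \<Omega> \<Longrightarrow> - hessian_trace L x = log_power p \<alpha> (u x)"
    "\<And>x. x \<in> \<Omega> \<Longrightarrow> - hessian_trace H x = log_power q \<beta> (v x)"
    using assms(13,14) u(2) v(2) u0(1) v0(1) by (auto simp: log_power_def in_closure max_absorb1)
  have signs: "\<And>x. x \<in> \<Omega> \<Longrightarrow> hessian_trace H x \<le> 0" "\<And>x. x \<in> \<Omega> \<Longrightarrow> hessian_trace L x \<le> 0"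
    using eqs log_power_nonneg by (metis neg_0_le_iff_le)+
  let ?N = "real CARD('n)"
  define E where "E = integral \<Omega> (\<lambda>x. u x * log_power p \<alpha> (u x))"
  define \<psi> where "\<psi> = (\<lambda>x. - (x \<bullet> K x))"
  define P where "P = (\<lambda>x. - (hessian_apply L x x + K x))"
  have \<psi>: "C1_with_gradient \<Omega> \<psi> P"
    unfolding \<psi>_def P_def by (rule C1_minus[OF C1_position_dot_gradient[OF v(1)]])
  have upper: "flux G H \<psi> P \<le> (?N * (1 / (p + 1) + 1 / (q + 1)) - (?N - 2)) * E"
    using pohozaev_inequality[OF u(1) u0 v(1) v0 eqs assms(5-8)] unfolding \<psi>_def P_def E_def by simp
  have cont: "continuous_on (closure \<Omega>) (\<lambda>x. u x * log_power p \<alpha> (u x))"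
    using C2_D(3)[OF u(1)] continuous_on_compose2[OF continuous_log_power[OF assms(5)] C2_D(3)[OF u(1)]]
    by (intro continuous_intros) auto
  have E_nonneg: "0 \<le> E"
    unfolding E_def
    using u0(1) log_power_nonneg by (intro integral_nonneg integrable_closure cont mult_nonneg_nonneg) auto
  have v_from_u: "v x = 0" if "\<And>y. y \<in> \<Omega> \<Longrightarrow> u y = 0" "x \<in> \<Omega>" for x
    using zero_source[OF u(1) that] eqs(2)[OF that(2)] log_power_eq_0[OF assms(6)] v0(1) that(2) by auto
  have u_from_v: "u x = 0" if "\<And>y. y \<in> \<Omega> \<Longrightarrow> v y = 0" "x \<in> \<Omega>" for x
    using zero_source[OF v(1) that] eqs(1)[OF that(2)] log_power_eq_0[OF assms(5)] u0(1) that(2) by auto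
  have lower: "(\<forall>x\<in>frontier \<Omega>. 0 \<le> \<psi> x) \<and> 0 \<le> flux G H \<psi> P" if star: "star_shaped_0 \<Omega> \<nu>"
  proof
    show fr: "\<forall>x\<in>frontier \<Omega>. 0 \<le> \<psi> x"
    proof
      fix x assume x: "x \<in> frontier \<Omega>"
      then obtain e \<gamma> D where g: "C1_graph_at \<Omega> x e \<gamma>" "GDERIV \<gamma> x :> D" "\<nu> x = sgn (D - e)"
        using assms(4) unfolding exterior_unit_normal_def by blast
      have "0 \<le> x \<bullet> sgn (D - e)" using star x g(3) unfolding star_shaped_0_def by metis
      from frontier_position_derivative_nonpos[OF g(1,2) x this C2_D(1)[OF v(1)]] v0 x
      show "0 \<le> \<psi> x" by (simp add: \<psi>_def in_closure)
    qed
    show "0 \<le> flux G H \<psi> P" using fr by (intro flux_nonneg_frontier[OF u(1) u0 signs(1) \<psi>]) auto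
  qed
  have "\<forall>x\<in>\<Omega>. u x = 0 \<and> v x = 0"
    if sub: "1 / (p + 1) + 1 / (q + 1) < (?N - 2) / ?N" and star: "star_shaped_0 \<Omega> \<nu>"
  proof -
    have "?N * (1 / (p + 1) + 1 / (q + 1)) < ?N - 2"
      using sub assms(1) by (simp add: pos_less_divide_eq mult.commute)
    moreover have "0 \<le> (?N * (1 / (p + 1) + 1 / (q + 1)) - (?N - 2)) * E"
      using upper lower[OF star] by linarith
    ultimately have "E \<le> 0" by (simp add: zero_le_mult_iff)
    have "u x = 0" if x: "x \<in> \<Omega>" for x
    proof -
      have "u x * log_power p \<alpha> (u x) = 0"
      proof (rule zero_of_integral_nonpos[OF cont _ _ x])
        show "0 \<le> u y * log_power p \<alpha> (u y)" if "y \<in> \<Omega>" for y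
          using u0(1)[OF in_closure[OF that]] log_power_nonneg by simp
        show "integral \<Omega> (\<lambda>x. u x * log_power p \<alpha> (u x)) \<le> 0" using \<open>E \<le> 0\<close> E_def by simp
      qed
      then show ?thesis using log_power_eq_0[OF assms(5) u0(1)[OF in_closure[OF x]]] by auto
    qed
    then show ?thesis using v_from_u by blast
  qed
  moreover have "\<forall>x\<in>\<Omega>. u x = 0 \<and> v x = 0"
    if crit: "1 / (p + 1) + 1 / (q + 1) = (?N - 2) / ?N" and strong: "strongly_star_shaped_0 \<Omega> \<nu>"
  proof -
    have star: "star_shaped_0 \<Omega> \<nu>"
      using strong by (simp add: strongly_star_shaped_0_def star_shaped_0_def)
    obtain a where a: "a \<in> frontier \<Omega>" "0 < a \<bullet> \<nu> a"
      using strong unfolding strongly_star_shaped_0_def by (metis order_le_less)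
    have "?N * (1 / (p + 1) + 1 / (q + 1)) = ?N - 2" using crit assms(1) by (simp add: field_simps)
    then have flux0: "flux G H \<psi> P = 0" using upper lower[OF star] by simp
    have fr: "\<And>x. x \<in> frontier \<Omega> \<Longrightarrow> 0 \<le> \<psi> x" using lower[OF star] by blast
    \<comment> \<open>In the first case \<open>u\<close> has no flux near \<open>b\<close>, in the second \<open>v\<close> has none near \<open>a\<close>.\<close>
    show ?thesis
    proof (cases "\<exists>b\<in>frontier \<Omega>. 0 < \<psi> b")
      case True
      then obtain b where b: "b \<in> frontier \<Omega>" "0 < \<psi> b" by blast
      obtain r where r: "r > 0" "\<And>\<phi> Q. C1_with_gradient \<Omega> \<phi> Q \<Longrightarrow> (\<And>x. 0 \<le> \<phi> x) \<Longrightarrow>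
          (\<And>x. x \<notin> ball b r \<Longrightarrow> \<phi> x = 0) \<Longrightarrow> flux G H \<phi> Q = 0"
        using flux_localizes[OF u(1) u0 signs(1) \<psi> fr flux0 b] by blast
      obtain e \<gamma> where g: "C1_graph_at \<Omega> b e \<gamma>" using assms(3) b(1) unfolding C1_boundary_def by blast
      have "u x = 0" if "x \<in> \<Omega>" for x
        by (rule zero_if_flux_vanishes_near_frontier_point[OF u(1) u0 signs(1) dom(3) b(1) g r that])
      then show ?thesis using v_from_u by blast
    next
      case False
      have radial: "y \<bullet> K y = 0" if "y \<in> frontier \<Omega>" for y
        using fr[OF that] False that by (force simp: \<psi>_def)
      obtain e \<gamma> D where g: "C1_graph_at \<Omega> a e \<gamma>" "GDERIV \<gamma> a :> D" "\<nu> a = sgn (D - e)"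
        using assms(4) a(1) unfolding exterior_unit_normal_def by blast
      have "0 < a \<bullet> sgn (D - e)" using a(2) g(3) by simp
      then obtain r where r: "r > 0" "\<And>y. y \<in> frontier \<Omega> \<Longrightarrow> y \<in> ball a r \<Longrightarrow> K y = 0"
        using gradient_zero_on_transversal_frontier[OF g(1,2) _ C2_D(1)[OF v(1)] _ v0(2) radial] v0(1) in_closure
        by blast
      have vanish: "flux K L \<phi> Q = 0"
        if "C1_with_gradient \<Omega> \<phi> Q" "\<And>x. 0 \<le> \<phi> x" "\<And>x. x \<notin> ball a r \<Longrightarrow> \<phi> x = 0" for \<phi> Q
        using that r(2) by (intro flux_zero[OF v(1)]) auto
      have "v x = 0" if "x \<in> \<Omega>" for x
        by (rule zero_if_flux_vanishes_near_frontier_point[OF v(1) v0 signs(2) dom(3) a(1) g(1) r(1) vanish that])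
      then show ?thesis using u_from_v by blast
    qed
  qed
  ultimately show ?thesis by blast
qed

end
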